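(* Suppose that $A\subset\bar M$ is small and that $p(x)\in S_1(\bar M)$ is $A$-invariant and regular. (i) If $p$ is symmetric, then $\operatorname{cl}_{p_A}$ is a pregeometry operator on $A\cup (p|A)(\bar M)$. In the case where $(p(x),x=x)$ is strongly regular, $\operatorname{cl}^A_p$ is a pregeometry operator on $\bar M$. (ii) If $p$ is not symmetric, then there exist a finite extension $A_0$ of $A$ (i.e. $A_0\supseteq A$ with $A_0\setminus A$ finite) and an $A_0$-definable partial order $\leq$ such that every Morley sequence in $p$ over $A_0$ is strictly increasing.
   Context: $T$ is an arbitrary complete one-sorted first-order theory and $\bar M$ a saturated (monster) model of $T$; small means of cardinality less than $|\bar M|$. A global type is a complete type over $\bar M$; $p|B$ is the restriction of $p$ to parameters in $B$, and $(p|A)(\bar M)$ is the set of realizations of $p|A$ in $\bar M$. A global type is $A$-invariant if it is $\mathrm{Aut}(\bar M/A)$-invariant, and invariant if it is $A$-invariant for some small $A$. For $p$ $A$-invariant, $p^{(n)}(x_1,\dots,x_n)$ is the global type defined inductively by $p^{(1)}=p$ and: $\phi(x_1,\dots,x_{n+1},\bar c)\in p^{(n+1)}$ iff for some (any) $(a_1,\dots,a_n)$ realizing $p^{(n)}|(A,\bar c)$, $\phi(a_1,\dots,a_n,x_{n+1},\bar c)\in p(x_{n+1})$. A Morley sequence in $p$ over $A$ is a sequence $(a_i)$ in $\bar M$ with $a_i\models p|(A\cup\{a_j:j<i\})$ for all $i$. An invariant global type $p$ is symmetric if for every $n$, every formula $\phi(x_1,\dots,x_n)$ over $\bar M$ and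 every permutation $\pi$ of $\{1,\dots,n\}$: $\phi(x_1,\dots,x_n)\in p^{(n)}(x_1,\dots,x_n)$ iff $\phi(x_{\pi(1)},\dots,x_{\pi(n)})\in p^{(n)}(x_1,\dots,x_n)$. A non-algebraic global type $p$ is regular if for some small set $C$, $p$ is $C$-invariant and for every $B\supseteq C$ and every $a\models p|C$, either $a\models p|B$ or $p|B\vdash p|Ba$. For a non-algebraic global type $p$ and $\phi(x)\in p$, $(p(x),\phi(x))$ is strongly regular if for some small $C$ over which $\phi$ is defined, $p$ is $C$-invariant and for every $B\supseteq C$ and every $a$ satisfying $\phi(x)$, either $a\models p|B$ or $p|B\vdash p|Ba$. Operators: for $X\subseteq \bar M$, $\operatorname{cl}_p(X)=\{a\in\bar M: a\not\models p|X\}$ and $\operatorname{cl}_p^A(X)=\operatorname{cl}_p(X\cup A)$. For $B\subseteq A\cup(p|A)(\bar M)$, $\operatorname{cl}_{p_A}(B)=A\cup(\operatorname{cl}^A_p(B)\cap (p|A)(\bar M))$. An operator $\operatorname{cl}$ on subsets of a set $P$ is a pregeometry operator if it satisfies monotonicity ($X\subseteq Y$ implies $X\subseteq\operatorname{cl}(X)\subseteq\operatorname{cl}(Y)$), finite character ($\operatorname{cl}(X)$ is the union of $\operatorname{cl}(X_0)$ over finite $X_0\subseteq X$), transitivity ($\operatorname{cl}(\operatorname{cl}(X))=\operatorname{cl}(X)$) and exchange ($a\in\operatorname{cl}(X\cup\{b\})\setminus\operatorname{cl}(X)$ implies $b\in\operatorname{cl}(X\cup\{a\})$).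
   Formalization: In the first claim of (i), regularity of p is assumed to be witnessed by A itself (C = A in the definition); if only some other small C witnesses regularity, the operator cl_{p_A} can fail to be transitive. *)

theory Defs
  imports Main "HOL-Combinatorics.Permutations"
begin

unbundle cardinal_syntax

(* Formulas with parameters: Var is a de Bruijn index and Par a is a constant naming the
   element a of the model.  Outside quantifiers, Var i is the free variable x_(i+1). *)

datatype (dead 'f, params_tm: 'm) tm =
    Var nat
  | Par 'm
  | Fn 'f "('f, 'm) tm list"
  for map: map_tm

datatype (dead 'f, dead 'r, params: 'm) fm =
    Eq "('f, 'm) tm" "('f, 'm) tm"
  | Rel 'r "('f, 'm) tm list"
  | Neg "('f, 'r, 'm) fm"
  | Conj "('f, 'r, 'm) fm" "('f, 'r, 'm) fm"
  | Ex "('f, 'r, 'm) fm"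
  for map: map_fm

fun fv_tm :: "('f, 'm) tm \<Rightarrow> nat set" where
  "fv_tm (Var i) = {i}"
| "fv_tm (Par a) = {}"
| "fv_tm (Fn f ts) = (\<Union>t\<in>set ts. fv_tm t)"

fun fv :: "('f, 'r, 'm) fm \<Rightarrow> nat set" where
  "fv (Eq s t) = fv_tm s \<union> fv_tm t"
| "fv (Rel r ts) = (\<Union>t\<in>set ts. fv_tm t)"
| "fv (Neg \<phi>) = fv \<phi>"
| "fv (Conj \<phi> \<psi>) = fv \<phi> \<union> fv \<psi>"
| "fv (Ex \<phi>) = {i. Suc i \<in> fv \<phi>}"

fun subst_tm :: "(nat \<Rightarrow> ('f, 'm) tm) \<Rightarrow> ('f, 'm) tm \<Rightarrow> ('f, 'm) tm" where
  "subst_tm s (Var i) = s i"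
| "subst_tm s (Par a) = Par a"
| "subst_tm s (Fn f ts) = Fn f (map (subst_tm s) ts)"

definition lift_subst :: "(nat \<Rightarrow> ('f, 'm) tm) \<Rightarrow> nat \<Rightarrow> ('f, 'm) tm" where
  "lift_subst s = case_nat (Var 0) (\<lambda>i. subst_tm (\<lambda>j. Var (Suc j)) (s i))"

fun subst :: "(nat \<Rightarrow> ('f, 'm) tm) \<Rightarrow> ('f, 'r, 'm) fm \<Rightarrow> ('f, 'r, 'm) fm" where
  "subst s (Eq t u) = Eq (subst_tm s t) (subst_tm s u)"
| "subst s (Rel r ts) = Rel r (map (subst_tm s) ts)"
| "subst s (Neg \<phi>) = Neg (subst s \<phi>)"
| "subst s (Conj \<phi> \<psi>) = Conj (subst s \<phi>) (subst s \<psi>)"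
| "subst s (Ex \<phi>) = Ex (subst (lift_subst s) \<phi>)"

(* The universe of a model is the whole type 'm.  The signature is a set of symbols paired with
   their arities (constants are function symbols of arity 0), so either part may be empty;
   fint and rint matter only at lists of the right length.  The complete theory T under
   consideration is the theory of the model. *)

record ('f, 'r, 'm) model =
  fsig :: "('f \<times> nat) set"
  rsig :: "('r \<times> nat) set"
  fint :: "'f \<Rightarrow> 'm list \<Rightarrow> 'm"
  rint :: "'r \<Rightarrow> 'm list \<Rightarrow> bool"

fun wf_tm :: "('f, 'r, 'm) model \<Rightarrow> ('f, 'm) tm \<Rightarrow> bool" where
  "wf_tm M (Var i) \<longleftrightarrow> True"
| "wf_tm M (Par a) \<longleftrightarrow> True"
| "wf_tm M (Fn f ts) \<longleftrightarrow> (f, length ts) \<in> fsig M \<and> (\<forall>t\<in>set ts. wf_tm M t)"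

fun wf_fm :: "('f, 'r, 'm) model \<Rightarrow> ('f, 'r, 'm) fm \<Rightarrow> bool" where
  "wf_fm M (Eq s t) \<longleftrightarrow> wf_tm M s \<and> wf_tm M t"
| "wf_fm M (Rel r ts) \<longleftrightarrow> (r, length ts) \<in> rsig M \<and> (\<forall>t\<in>set ts. wf_tm M t)"
| "wf_fm M (Neg \<phi>) \<longleftrightarrow> wf_fm M \<phi>"
| "wf_fm M (Conj \<phi> \<psi>) \<longleftrightarrow> wf_fm M \<phi> \<and> wf_fm M \<psi>"
| "wf_fm M (Ex \<phi>) \<longleftrightarrow> wf_fm M \<phi>"

fun eval_tm :: "('f, 'r, 'm) model \<Rightarrow> (nat \<Rightarrow> 'm) \<Rightarrow> ('f, 'm) tm \<Rightarrow> 'm" where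
  "eval_tm M e (Var i) = e i"
| "eval_tm M e (Par a) = a"
| "eval_tm M e (Fn f ts) = fint M f (map (eval_tm M e) ts)"

fun sat :: "('f, 'r, 'm) model \<Rightarrow> (nat \<Rightarrow> 'm) \<Rightarrow> ('f, 'r, 'm) fm \<Rightarrow> bool" where
  "sat M e (Eq s t) \<longleftrightarrow> eval_tm M e s = eval_tm M e t"
| "sat M e (Rel r ts) \<longleftrightarrow> rint M r (map (eval_tm M e) ts)"
| "sat M e (Neg \<phi>) \<longleftrightarrow> \<not> sat M e \<phi>"
| "sat M e (Conj \<phi> \<psi>) \<longleftrightarrow> sat M e \<phi> \<and> sat M e \<psi>"
| "sat M e (Ex \<phi>) \<longleftrightarrow> (\<exists>a. sat M (case_nat a e) \<phi>)"

definition formulas :: "('f, 'r, 'm) model \<Rightarrow> nat \<Rightarrow> 'm set \<Rightarrow> ('f, 'r, 'm) fm set" where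
  "formulas M n B = {\<phi>. wf_fm M \<phi> \<and> fv \<phi> \<subseteq> {..<n} \<and> params \<phi> \<subseteq> B}"

definition realizes ::
  "('f, 'r, 'm) model \<Rightarrow> (nat \<Rightarrow> 'm) \<Rightarrow> ('f, 'r, 'm) fm set \<Rightarrow> bool" where
  "realizes M e \<Phi> \<longleftrightarrow> (\<forall>\<phi>\<in>\<Phi>. sat M e \<phi>)"

abbreviation realizes1 :: "('f, 'r, 'm) model \<Rightarrow> 'm \<Rightarrow> ('f, 'r, 'm) fm set \<Rightarrow> bool" where
  "realizes1 M a \<Phi> \<equiv> realizes M (\<lambda>_. a) \<Phi>"

definition realizations :: "('f, 'r, 'm) model \<Rightarrow> ('f, 'r, 'm) fm set \<Rightarrow> 'm set" where
  "realizations M \<Phi> = {a. realizes1 M a \<Phi>}"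

(* Consistency with the elementary diagram of M, in the form given by compactness. *)
definition finitely_satisfiable ::
  "('f, 'r, 'm) model \<Rightarrow> ('f, 'r, 'm) fm set \<Rightarrow> bool" where
  "finitely_satisfiable M \<Phi> \<longleftrightarrow> (\<forall>\<Phi>0 \<subseteq> \<Phi>. finite \<Phi>0 \<longrightarrow> (\<exists>e. realizes M e \<Phi>0))"

(* Entailment modulo the elementary diagram of M, in the form given by compactness. *)
definition entails ::
  "('f, 'r, 'm) model \<Rightarrow> ('f, 'r, 'm) fm set \<Rightarrow> ('f, 'r, 'm) fm set \<Rightarrow> bool" where
  "entails M \<Phi> \<Psi> \<longleftrightarrow>
     (\<forall>\<psi>\<in>\<Psi>. \<exists>\<Phi>0 \<subseteq> \<Phi>. finite \<Phi>0 \<and> (\<forall>e. realizes M e \<Phi>0 \<longrightarrow> sat M e \<psi>))"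

definition small :: "'m set \<Rightarrow> bool" where
  "small A \<longleftrightarrow> |A| <o |UNIV :: 'm set|"

definition saturated :: "('f, 'r, 'm) model \<Rightarrow> bool" where
  "saturated M \<longleftrightarrow>
     (\<forall>B \<Phi>. small B \<longrightarrow> \<Phi> \<subseteq> formulas M 1 B \<longrightarrow> finitely_satisfiable M \<Phi> \<longrightarrow>
        (\<exists>a. realizes1 M a \<Phi>))"

definition complete_type ::
  "('f, 'r, 'm) model \<Rightarrow> nat \<Rightarrow> 'm set \<Rightarrow> ('f, 'r, 'm) fm set \<Rightarrow> bool" where
  "complete_type M n B q \<longleftrightarrow>
     q \<subseteq> formulas M n B \<and> finitely_satisfiable M q \<and>
     (\<forall>\<phi>\<in>formulas M n B. \<phi> \<in> q \<or> Neg \<phi> \<in> q)"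

abbreviation global_type :: "('f, 'r, 'm) model \<Rightarrow> ('f, 'r, 'm) fm set \<Rightarrow> bool" where
  "global_type M p \<equiv> complete_type M 1 UNIV p"

definition tp_restrict :: "('f, 'r, 'm) fm set \<Rightarrow> 'm set \<Rightarrow> ('f, 'r, 'm) fm set" where
  "tp_restrict p B = {\<phi>\<in>p. params \<phi> \<subseteq> B}"

definition automorphism :: "('f, 'r, 'm) model \<Rightarrow> ('m \<Rightarrow> 'm) \<Rightarrow> bool" where
  "automorphism M \<sigma> \<longleftrightarrow> bij \<sigma> \<and>
     (\<forall>f as. (f, length as) \<in> fsig M \<longrightarrow> \<sigma> (fint M f as) = fint M f (map \<sigma> as)) \<and>
     (\<forall>r as. (r, length as) \<in> rsig M \<longrightarrow> rint M r as = rint M r (map \<sigma> as))"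

definition invariant_over ::
  "('f, 'r, 'm) model \<Rightarrow> 'm set \<Rightarrow> ('f, 'r, 'm) fm set \<Rightarrow> bool" where
  "invariant_over M A p \<longleftrightarrow>
     (\<forall>\<sigma>. automorphism M \<sigma> \<and> (\<forall>a\<in>A. \<sigma> a = a) \<longrightarrow> map_fm \<sigma> ` p = p)"

(* The n-th power of an A-invariant global type p, in the variables Var 0, ..., Var (n - 1).
   A tuple (a_1, ..., a_n) is given by an assignment e of which only e 0, ..., e (n - 1) matter.
   By invariance the choice of the realization is irrelevant, and so is the choice of A.
   The value at n = 0 is a dummy. *)
fun type_power ::
  "('f, 'r, 'm) model \<Rightarrow> 'm set \<Rightarrow> ('f, 'r, 'm) fm set \<Rightarrow> nat \<Rightarrow> ('f, 'r, 'm) fm set" where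
  "type_power M A p 0 = {}"
| "type_power M A p (Suc 0) = p"
| "type_power M A p (Suc (Suc k)) =
     {\<phi> \<in> formulas M (Suc (Suc k)) UNIV.
        \<exists>e. realizes M e (tp_restrict (type_power M A p (Suc k)) (A \<union> params \<phi>)) \<and>
            subst (\<lambda>i. if i < Suc k then Par (e i) else Var (i - Suc k)) \<phi> \<in> p}"

definition symmetric_type ::
  "('f, 'r, 'm) model \<Rightarrow> 'm set \<Rightarrow> ('f, 'r, 'm) fm set \<Rightarrow> bool" where
  "symmetric_type M A p \<longleftrightarrow>
     (\<forall>n\<ge>1. \<forall>\<phi>\<in>formulas M n UNIV. \<forall>\<pi>. \<pi> permutes {..<n} \<longrightarrow>
        (\<phi> \<in> type_power M A p n \<longleftrightarrow> subst (\<lambda>i. Var (\<pi> i)) \<phi> \<in> type_power M A p n))"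

(* Indexed by the field of a linear order r, which covers finite and ordinal-indexed sequences.
   A Morley sequence in a nonalgebraic type is injective, so up to reindexing r may be taken on
   the universe 'm itself. *)
definition morley_sequence ::
  "('f, 'r, 'm) model \<Rightarrow> ('f, 'r, 'm) fm set \<Rightarrow> 'm set \<Rightarrow> 'i rel \<Rightarrow> ('i \<Rightarrow> 'm) \<Rightarrow> bool" where
  "morley_sequence M p A r a \<longleftrightarrow> Linear_order r \<and>
     (\<forall>i\<in>Field r. realizes1 M (a i) (tp_restrict p (A \<union> a ` underS r i)))"

definition nonalgebraic :: "('f, 'r, 'm) model \<Rightarrow> ('f, 'r, 'm) fm set \<Rightarrow> bool" where
  "nonalgebraic M p \<longleftrightarrow> (\<forall>\<phi>\<in>p. infinite {a. sat M (\<lambda>_. a) \<phi>})"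

definition realizes_or_entails ::
  "('f, 'r, 'm) model \<Rightarrow> ('f, 'r, 'm) fm set \<Rightarrow> 'm set \<Rightarrow> 'm \<Rightarrow> bool" where
  "realizes_or_entails M p B a \<longleftrightarrow>
     realizes1 M a (tp_restrict p B) \<or> entails M (tp_restrict p B) (tp_restrict p (insert a B))"

(* C witnesses regularity.  The sets B range over all supersets of C, not only small ones;
   since entails is finitary this makes no difference. *)
definition regular_over ::
  "('f, 'r, 'm) model \<Rightarrow> 'm set \<Rightarrow> ('f, 'r, 'm) fm set \<Rightarrow> bool" where
  "regular_over M C p \<longleftrightarrow> invariant_over M C p \<and>
     (\<forall>B a. C \<subseteq> B \<longrightarrow> realizes1 M a (tp_restrict p C) \<longrightarrow> realizes_or_entails M p B a)"

definition regular :: "('f, 'r, 'm) model \<Rightarrow> ('f, 'r, 'm) fm set \<Rightarrow> bool" where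
  "regular M p \<longleftrightarrow> nonalgebraic M p \<and> (\<exists>C. small C \<and> regular_over M C p)"

definition strongly_regular ::
  "('f, 'r, 'm) model \<Rightarrow> ('f, 'r, 'm) fm set \<Rightarrow> ('f, 'r, 'm) fm \<Rightarrow> bool" where
  "strongly_regular M p \<phi> \<longleftrightarrow> nonalgebraic M p \<and> \<phi> \<in> p \<and>
     (\<exists>C. small C \<and> params \<phi> \<subseteq> C \<and> invariant_over M C p \<and>
        (\<forall>B a. C \<subseteq> B \<longrightarrow> sat M (\<lambda>_. a) \<phi> \<longrightarrow> realizes_or_entails M p B a))"

definition cl_type :: "('f, 'r, 'm) model \<Rightarrow> ('f, 'r, 'm) fm set \<Rightarrow> 'm set \<Rightarrow> 'm set" where
  "cl_type M p X = {a. \<not> realizes1 M a (tp_restrict p X)}"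

definition cl_type_over ::
  "('f, 'r, 'm) model \<Rightarrow> 'm set \<Rightarrow> ('f, 'r, 'm) fm set \<Rightarrow> 'm set \<Rightarrow> 'm set" where
  "cl_type_over M A p X = cl_type M p (X \<union> A)"

definition cl_local ::
  "('f, 'r, 'm) model \<Rightarrow> 'm set \<Rightarrow> ('f, 'r, 'm) fm set \<Rightarrow> 'm set \<Rightarrow> 'm set" where
  "cl_local M A p X = A \<union> (cl_type_over M A p X \<inter> realizations M (tp_restrict p A))"

definition pregeometry_on :: "'a set \<Rightarrow> ('a set \<Rightarrow> 'a set) \<Rightarrow> bool" where
  "pregeometry_on P cl \<longleftrightarrow>
     (\<forall>X\<subseteq>P. cl X \<subseteq> P) \<and>
     (\<forall>X Y. X \<subseteq> Y \<longrightarrow> Y \<subseteq> P \<longrightarrow> X \<subseteq> cl X \<and> cl X \<subseteq> cl Y) \<and>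
     (\<forall>X\<subseteq>P. cl X = (\<Union>X0\<in>{X0. finite X0 \<and> X0 \<subseteq> X}. cl X0)) \<and>
     (\<forall>X\<subseteq>P. cl (cl X) = cl X) \<and>
     (\<forall>X\<subseteq>P. \<forall>a\<in>P. \<forall>b\<in>P. a \<in> cl (insert b X) - cl X \<longrightarrow> b \<in> cl (insert a X))"

definition definable_relation ::
  "('f, 'r, 'm) model \<Rightarrow> ('f, 'r, 'm) fm \<Rightarrow> 'm rel" where
  "definable_relation M \<psi> = {(x, y). sat M ((\<lambda>_. y)(0 := x)) \<psi>}"

definition strictly_increasing :: "'i rel \<Rightarrow> 'm rel \<Rightarrow> ('i \<Rightarrow> 'm) \<Rightarrow> bool" where
  "strictly_increasing r R a \<longleftrightarrow>
     (\<forall>i j. (i, j) \<in> r \<and> i \<noteq> j \<longrightarrow> (a i, a j) \<in> R \<and> a i \<noteq> a j)"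

end

(*
  Call an element generic over B if it realizes p|B.

  (i) Regularity says that adding a non-generic element to B does not destroy genericity over B;
  iterating this over finitely many elements gives transitivity.  Symmetry for pairs says that if a is
  generic over B and b over Ba, then a is generic over Bb, which is exchange.

  (ii) If every such pair could be exchanged over finite extensions of A, any permutation of a finite
  Morley sequence would be one, so p would be symmetric.  Hence there are F finite and phi over AF such
  that phi(a,b) holds for Morley pairs (a,b) over AF, but phi(x,b) is not in p(x).  Let p be
  regular over C, put D = AFC and let (a,b) be a Morley pair over D.  If z realizes p|D and phi(z,a)
  holds, then z is not generic over Da, so b is generic over Dz by regularity and phi(z,b) holds.  By
  saturation some theta in p|D already satisfies: theta(z) and phi(z,a) imply phi(z,b).  With
  phi'(z,y) = theta(z) & phi(z,y), the quasi-order "phi'(z,x) implies phi'(z,y) for all z" puts a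
  below b, strictly because of an element lying between a and b in a Morley sequence.  It uses only
  finitely many parameters from C.
*)
theory Submission
  imports Defs
begin

section \<open>Formulas and substitution\<close>

lemma eval_tm_cong: "(\<And>i. i \<in> fv_tm t \<Longrightarrow> e i = e' i) \<Longrightarrow> eval_tm M e t = eval_tm M e' t"
proof (induction t)
  case (Fn f ts)
  then have "map (eval_tm M e) ts = map (eval_tm M e') ts"
    by auto
  then show ?case by (simp del: map_eq_conv)
qed auto

lemma sat_cong: "(\<And>i. i \<in> fv \<phi> \<Longrightarrow> e i = e' i) \<Longrightarrow> sat M e \<phi> \<longleftrightarrow> sat M e' \<phi>"
proof (induction \<phi> arbitrary: e e')
  case (Eq s t)
  then have "eval_tm M e s = eval_tm M e' s" "eval_tm M e t = eval_tm M e' t"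
    by (auto intro!: eval_tm_cong)
  then show ?case by simp
next
  case (Rel r ts)
  then have "map (eval_tm M e) ts = map (eval_tm M e') ts"
    by (auto intro!: eval_tm_cong)
  then show ?case by (simp del: map_eq_conv)
next
  case (Neg \<phi>)
  then show ?case by (metis fv.simps(3) sat.simps(3))
next
  case (Conj \<phi> \<psi>)
  then show ?case by (metis UnCI fv.simps(4) sat.simps(4))
next
  case (Ex \<phi>)
  have "sat M (case_nat a e) \<phi> \<longleftrightarrow> sat M (case_nat a e') \<phi>" for a
    using Ex.prems by (intro Ex.IH) (auto split: nat.split)
  then show ?case by simp
qed

lemma sat_cong_formulas:
  "\<phi> \<in> formulas M n B \<Longrightarrow> (\<And>i. i < n \<Longrightarrow> e i = e' i) \<Longrightarrow> sat M e \<phi> \<longleftrightarrow> sat M e' \<phi>"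
  by (intro sat_cong) (auto simp: formulas_def)

lemma eval_subst_tm: "eval_tm M e (subst_tm s t) = eval_tm M (\<lambda>i. eval_tm M e (s i)) t"
  by (induction t) (auto intro!: arg_cong[where f = "fint M _"])

lemma sat_subst: "sat M e (subst s \<phi>) \<longleftrightarrow> sat M (\<lambda>i. eval_tm M e (s i)) \<phi>"
proof (induction \<phi> arbitrary: e s)
  case (Ex \<phi>)
  have "(\<lambda>i. eval_tm M (case_nat a e) (lift_subst s i)) = case_nat a (\<lambda>i. eval_tm M e (s i))" for a
    by (auto simp: fun_eq_iff lift_subst_def eval_subst_tm split: nat.split)
  with Ex show ?case by simp
qed (simp_all add: eval_subst_tm comp_def)

lemma wf_subst_tm: "wf_tm M t \<Longrightarrow> (\<And>i. i \<in> fv_tm t \<Longrightarrow> wf_tm M (s i)) \<Longrightarrow> wf_tm M (subst_tm s t)"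
  by (induction t) auto

lemma fv_subst_tm: "fv_tm (subst_tm s t) = (\<Union>i\<in>fv_tm t. fv_tm (s i))"
  by (induction t) auto

lemma params_subst_tm: "params_tm (subst_tm s t) = params_tm t \<union> (\<Union>i\<in>fv_tm t. params_tm (s i))"
  by (induction t) auto

lemma wf_subst: "wf_fm M \<phi> \<Longrightarrow> (\<And>i. i \<in> fv \<phi> \<Longrightarrow> wf_tm M (s i)) \<Longrightarrow> wf_fm M (subst s \<phi>)"
proof (induction \<phi> arbitrary: s)
  case (Ex \<phi>)
  have "wf_tm M (lift_subst s i)" if "i \<in> fv \<phi>" for i
    using Ex.prems that by (auto simp: lift_subst_def intro!: wf_subst_tm split: nat.split)
  with Ex show ?case by simp
qed (auto intro!: wf_subst_tm)

lemma fv_subst: "fv (subst s \<phi>) = (\<Union>i\<in>fv \<phi>. fv_tm (s i))"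
proof (induction \<phi> arbitrary: s)
  case (Ex \<phi>)
  have "Suc j \<in> fv_tm (lift_subst s i) \<longleftrightarrow> (\<exists>k. i = Suc k \<and> j \<in> fv_tm (s k))" for i j
    by (auto simp: lift_subst_def fv_subst_tm split: nat.split)
  with Ex show ?case by auto
qed (auto simp: fv_subst_tm)

lemma params_subst: "params (subst s \<phi>) = params \<phi> \<union> (\<Union>i\<in>fv \<phi>. params_tm (s i))"
proof (induction \<phi> arbitrary: s)
  case (Ex \<phi>)
  have "params_tm (lift_subst s i) = (case i of 0 \<Rightarrow> {} | Suc k \<Rightarrow> params_tm (s k))" for i
    by (auto simp: lift_subst_def params_subst_tm split: nat.split)
  with Ex show ?case by (auto split: nat.splits)
qed (auto simp: params_subst_tm)

lemma finite_fv_tm: "finite (fv_tm t)"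
  by (induction t) auto

lemma finite_fv: "finite (fv \<phi>)"
proof (induction \<phi>)
  case (Ex \<phi>)
  have "fv (Ex \<phi>) = Suc -` fv \<phi>" by auto
  with Ex show ?case by (simp add: finite_vimageI)
qed (auto simp: finite_fv_tm)

lemma finite_params_tm: "finite (params_tm t)"
  by (induction t) auto

lemma finite_params: "finite (params \<phi>)"
  by (induction \<phi>) (auto simp: finite_params_tm)

section \<open>Trading a parameter for a free variable\<close>

fun abstract_tm :: "'m \<Rightarrow> nat \<Rightarrow> ('f, 'm) tm \<Rightarrow> ('f, 'm) tm" where
  "abstract_tm b k (Var i) = Var i"
| "abstract_tm b k (Par a) = (if a = b then Var k else Par a)"
| "abstract_tm b k (Fn f ts) = Fn f (map (abstract_tm b k) ts)"

text \<open>The index grows by one under each \<open>Ex\<close>, so that it keeps naming the same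
  outer variable. \<open>Var k\<close> may already occur in the formula: \<open>sat_abstract\<close>
  evaluates where \<open>e k = b\<close>, and there both uses agree.\<close>

fun abstract :: "'m \<Rightarrow> nat \<Rightarrow> ('f, 'r, 'm) fm \<Rightarrow> ('f, 'r, 'm) fm" where
  "abstract b k (Eq t u) = Eq (abstract_tm b k t) (abstract_tm b k u)"
| "abstract b k (Rel r ts) = Rel r (map (abstract_tm b k) ts)"
| "abstract b k (Neg \<phi>) = Neg (abstract b k \<phi>)"
| "abstract b k (Conj \<phi> \<psi>) = Conj (abstract b k \<phi>) (abstract b k \<psi>)"
| "abstract b k (Ex \<phi>) = Ex (abstract b (Suc k) \<phi>)"

lemma eval_abstract_tm: "e k = b \<Longrightarrow> eval_tm M e (abstract_tm b k t) = eval_tm M e t"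
  by (induction t) (auto intro!: arg_cong[where f = "fint M _"])

lemma sat_abstract: "e k = b \<Longrightarrow> sat M e (abstract b k \<phi>) \<longleftrightarrow> sat M e \<phi>"
proof (induction \<phi> arbitrary: e k)
  case (Rel r ts)
  then have "map (eval_tm M e) (map (abstract_tm b k) ts) = map (eval_tm M e) ts"
    by (simp add: eval_abstract_tm)
  then show ?case by (metis abstract.simps(2) sat.simps(2))
qed (simp_all add: eval_abstract_tm)

lemma wf_abstract_tm: "wf_tm M (abstract_tm b k t) \<longleftrightarrow> wf_tm M t"
  by (induction t) auto

lemma fv_abstract_tm: "fv_tm (abstract_tm b k t) \<subseteq> insert k (fv_tm t)"
proof (induction t)
  case (Fn f ts)
  then show ?case by fastforce
qed auto

lemma params_abstract_tm: "params_tm (abstract_tm b k t) = params_tm t - {b}"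
  by (induction t) auto

lemma wf_abstract: "wf_fm M (abstract b k \<phi>) \<longleftrightarrow> wf_fm M \<phi>"
  by (induction \<phi> arbitrary: k) (auto simp: wf_abstract_tm)

lemma fv_abstract: "fv (abstract b k \<phi>) \<subseteq> insert k (fv \<phi>)"
proof (induction \<phi> arbitrary: k)
  case (Eq t u)
  then show ?case using fv_abstract_tm[of b k t] fv_abstract_tm[of b k u] by auto
next
  case (Rel r ts)
  then show ?case using fv_abstract_tm[of b k] by fastforce
next
  case (Ex \<phi>)
  from Ex[of "Suc k"] show ?case by auto
qed auto

lemma params_abstract: "params (abstract b k \<phi>) = params \<phi> - {b}"
  by (induction \<phi> arbitrary: k) (auto simp: params_abstract_tm)

section \<open>Automorphisms and truth\<close>

lemma eval_automorphism:
  "automorphism M \<sigma> \<Longrightarrow> wf_tm M t \<Longrightarrow> eval_tm M (\<lambda>i. \<sigma> (e i)) (map_tm \<sigma> t) = \<sigma> (eval_tm M e t)"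
proof (induction t)
  case (Fn f ts)
  then have "map (eval_tm M (\<lambda>i. \<sigma> (e i))) (map (map_tm \<sigma>) ts) = map \<sigma> (map (eval_tm M e) ts)"
    by simp
  moreover have "\<sigma> (fint M f (map (eval_tm M e) ts)) = fint M f (map \<sigma> (map (eval_tm M e) ts))"
    using Fn.prems by (simp add: automorphism_def del: map_map)
  ultimately show ?case by (simp del: map_map map_eq_conv)
qed auto

lemma sat_automorphism:
  assumes "automorphism M \<sigma>"
  shows "wf_fm M \<phi> \<Longrightarrow> sat M (\<lambda>i. \<sigma> (e i)) (map_fm \<sigma> \<phi>) \<longleftrightarrow> sat M e \<phi>"
proof (induction \<phi> arbitrary: e)
  case (Eq t u)
  moreover have "inj \<sigma>" using assms by (auto simp: automorphism_def bij_def)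
  ultimately show ?case using assms by (simp add: eval_automorphism inj_eq)
next
  case (Rel r ts)
  then have "map (eval_tm M (\<lambda>i. \<sigma> (e i))) (map (map_tm \<sigma>) ts) = map \<sigma> (map (eval_tm M e) ts)"
    using assms by (simp add: eval_automorphism)
  moreover have rint: "rint M r as = rint M r (map \<sigma> as)" if "(r, length as) \<in> rsig M" for as
    using assms that unfolding automorphism_def by blast
  have "rint M r (map (eval_tm M e) ts) = rint M r (map \<sigma> (map (eval_tm M e) ts))"
    by (rule rint) (use Rel.prems in simp)
  ultimately show ?case by (simp del: map_map map_eq_conv)
next
  case (Ex \<phi>)
  have "(\<lambda>i. \<sigma> (case_nat a e i)) = case_nat (\<sigma> a) (\<lambda>i. \<sigma> (e i))" for a
    by (auto simp: fun_eq_iff split: nat.split)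
  then have "sat M (case_nat (\<sigma> a) (\<lambda>i. \<sigma> (e i))) (map_fm \<sigma> \<phi>) \<longleftrightarrow> sat M (case_nat a e) \<phi>" for a
    using Ex.IH[of "case_nat a e"] Ex.prems by simp
  moreover have "surj \<sigma>" using assms by (auto simp: automorphism_def bij_def)
  ultimately show ?case by simp (metis surjD)
qed auto

fun conjs :: "('f, 'r, 'm) fm list \<Rightarrow> ('f, 'r, 'm) fm" where
  "conjs [] = Eq (Var 0) (Var 0)"
| "conjs (\<phi> # \<phi>s) = Conj \<phi> (conjs \<phi>s)"

lemma sat_conjs: "sat M e (conjs \<phi>s) \<longleftrightarrow> (\<forall>\<phi>\<in>set \<phi>s. sat M e \<phi>)"
  by (induction \<phi>s) auto

lemma conjs_formulas:
  "0 < n \<Longrightarrow> set \<phi>s \<subseteq> formulas M n B \<Longrightarrow> conjs \<phi>s \<in> formulas M n B"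
  by (induction \<phi>s) (auto simp: formulas_def)

section \<open>Homogeneity of saturated models\<close>

text \<open>A partial elementary map, kept as a relation so that the back step is the forth step for
  the converse. Single-valuedness and injectivity are the case of the formula
  \<open>Eq (Var 0) (Var 1)\<close>.\<close>

definition elementary :: "('f, 'r, 'm) model \<Rightarrow> 'm rel \<Rightarrow> bool" where
  "elementary M R \<longleftrightarrow> (\<forall>\<phi> e e'. wf_fm M \<phi> \<longrightarrow> params \<phi> = {} \<longrightarrow>
     (\<forall>i\<in>fv \<phi>. (e i, e' i) \<in> R) \<longrightarrow> (sat M e \<phi> \<longleftrightarrow> sat M e' \<phi>))"

lemma elementaryD:
  "elementary M R \<Longrightarrow> wf_fm M \<phi> \<Longrightarrow> params \<phi> = {} \<Longrightarrow> (\<And>i. i \<in> fv \<phi> \<Longrightarrow> (e i, e' i) \<in> R)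
    \<Longrightarrow> sat M e \<phi> \<longleftrightarrow> sat M e' \<phi>"
  unfolding elementary_def by blast

text \<open>One direction suffices, because it also applies to \<open>Neg \<phi>\<close>.\<close>

lemma elementaryI:
  fixes M :: "('f, 'r, 'm) model"
  assumes "\<And>\<phi> e e'. wf_fm M \<phi> \<Longrightarrow> params \<phi> = {} \<Longrightarrow> (\<And>i. i \<in> fv \<phi> \<Longrightarrow> (e i, e' i) \<in> R)
    \<Longrightarrow> sat M e \<phi> \<Longrightarrow> sat M e' \<phi>"
  shows "elementary M R"
  unfolding elementary_def
proof (intro allI impI)
  fix \<phi> :: "('f, 'r, 'm) fm" and e e'
  assume *: "wf_fm M \<phi>" "params \<phi> = {}" "\<forall>i\<in>fv \<phi>. (e i, e' i) \<in> R"
  show "sat M e \<phi> \<longleftrightarrow> sat M e' \<phi>"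
    using assms[of \<phi> e e'] assms[of "Neg \<phi>" e e'] * by auto
qed

lemma elementary_converse: "elementary M R \<Longrightarrow> elementary M (R\<inverse>)"
  unfolding elementary_def converse_iff by metis

lemma elementary_mono: "elementary M R \<Longrightarrow> S \<subseteq> R \<Longrightarrow> elementary M S"
  unfolding elementary_def by blast

text \<open>A formula has finitely many free variables, so the pairs it involves lie in one member
  of the chain.\<close>

lemma elementary_chain:
  fixes M :: "('f, 'r, 'm) model"
  assumes "subset.chain UNIV \<R>" "\<R> \<noteq> {}" "\<And>R. R \<in> \<R> \<Longrightarrow> elementary M R"
  shows "elementary M (\<Union>\<R>)"
proof (rule elementaryI)
  fix \<phi> :: "('f, 'r, 'm) fm" and e e'
  assume *: "wf_fm M \<phi>" "params \<phi> = {}" "\<And>i. i \<in> fv \<phi> \<Longrightarrow> (e i, e' i) \<in> \<Union>\<R>" "sat M e \<phi>"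
  then have "(\<lambda>i. (e i, e' i)) ` fv \<phi> \<subseteq> \<Union>\<R>" by blast
  then obtain R where "R \<in> \<R>" "(\<lambda>i. (e i, e' i)) ` fv \<phi> \<subseteq> R"
    using finite_subset_Union_chain[OF finite_imageI[OF finite_fv] _ assms(2,1)] by blast
  then show "sat M e' \<phi>" using * assms(3) elementaryD[of M R \<phi> e e'] by auto
qed

text \<open>The forth step: \<open>y\<close> realizes the image under \<open>R\<close> of the type
  of \<open>x\<close> over the domain of \<open>R\<close>. The parameters of that image are values
  of \<open>R\<close>, whence the smallness of \<open>Range R\<close>.\<close>

lemma elementary_extend:
  fixes M :: "('f, 'r, 'm) model"
  assumes sat: "saturated M" and R: "elementary M R" and small: "small (Range R)"
  shows "\<exists>y. elementary M (insert (x, y) R)"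
proof -
  \<comment> \<open>\<open>good \<phi> e e'\<close> records a formula true of \<open>x\<close> at
    variable 0, with elements of the domain at the other free variables.
    \<open>inst \<phi> e'\<close> is what \<open>y\<close> must then satisfy, with the images as
    parameters; \<open>e' 0\<close> is never looked at.\<close>
  define good where "good = (\<lambda>\<phi> e e'. wf_fm M \<phi> \<and> params \<phi> = {} \<and> (\<forall>i\<in>fv \<phi>. i \<noteq> 0 \<longrightarrow> (e i, e' i) \<in> R) \<and>
    e 0 = x \<and> sat M e \<phi>)"
  define inst where "inst = (\<lambda>(\<phi> :: ('f, 'r, 'm) fm) e'. subst (case_nat (Var 0) (\<lambda>i. Par (e' (Suc i) :: 'm))) \<phi>)"
  define \<Phi> where "\<Phi> = {inst \<phi> e' | \<phi> e e'. good \<phi> e e'}"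
  have sat_inst: "sat M d (inst \<phi> e') \<longleftrightarrow> sat M (e'(0 := d 0)) \<phi>" for d \<phi> e'
    unfolding inst_def sat_subst by (rule sat_cong) (auto split: nat.split)
  have "\<Phi> \<subseteq> formulas M 1 (Range R)"
  proof
    fix \<psi> assume "\<psi> \<in> \<Phi>"
    then obtain \<phi> e e' where *: "\<psi> = inst \<phi> e'" "good \<phi> e e'" unfolding \<Phi>_def by blast
    then have "e' (Suc i) \<in> Range R" if "Suc i \<in> fv \<phi>" for i using that by (auto simp: good_def)
    with * show "\<psi> \<in> formulas M 1 (Range R)"
      unfolding formulas_def inst_def good_def
      by (auto simp: fv_subst params_subst intro!: wf_subst split: nat.splits)
  qed
  \<comment> \<open>Finitely many members of \<open>\<Phi>\<close> follow from a single good
    formula, so that elementarity of \<open>R\<close> can be applied to one formula.\<close>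
  have combine: "\<exists>\<phi> e e'. good \<phi> e e' \<and> (\<forall>y. sat M (e'(0 := y)) \<phi> \<longrightarrow> (\<forall>\<psi>\<in>F. sat M (\<lambda>_. y) \<psi>))"
    if "finite F" "F \<subseteq> \<Phi>" for F
    using that
  proof (induction F)
    case empty
    have "good (Eq (Var 0) (Var 0)) (\<lambda>_. x) (\<lambda>_. x)" by (auto simp: good_def)
    then show ?case by blast
  next
    case (insert \<psi> F)
    then obtain \<phi>1 e1 e1' where 1: "good \<phi>1 e1 e1'"
      "\<And>y. sat M (e1'(0 := y)) \<phi>1 \<Longrightarrow> (\<forall>\<psi>\<in>F. sat M (\<lambda>_. y) \<psi>)" by (metis insert_subset)
    from insert.prems obtain \<phi>2 e2 e2' where 2: "good \<phi>2 e2 e2'" "\<psi> = inst \<phi>2 e2'"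
      unfolding \<Phi>_def by auto
    \<comment> \<open>The variables of the two formulas are kept apart: variable \<open>k\<close> of
      \<open>\<phi>1\<close> goes to \<open>2 * k\<close>, variable \<open>k > 0\<close> of
      \<open>\<phi>2\<close> to \<open>2 * k - 1\<close>. Only variable 0, the place of
      \<open>x\<close>, is shared.\<close>
    define merge where "merge = (\<lambda>(f :: nat \<Rightarrow> 'm) g n. if n = 0 then x else if even n then f (n div 2) else g ((n + 1) div 2))"
    define r1 r2 :: "nat \<Rightarrow> ('f, 'm) tm" where "r1 = (\<lambda>i. Var (2 * i))" and
      "r2 = (\<lambda>i. if i = 0 then Var 0 else Var (2 * i - 1))"
    define \<phi> where "\<phi> = Conj (subst r1 \<phi>1) (subst r2 \<phi>2)"
    have r1: "eval_tm M ((merge f g)(0 := y)) (r1 i) = (f(0 := y)) i" for f g y i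
      by (auto simp: r1_def merge_def)
    have r2: "eval_tm M ((merge f g)(0 := y)) (r2 i) = (g(0 := y)) i" for f g y i
    proof (cases i)
      case (Suc k)
      then have "2 * i - 1 = Suc (2 * k)" by simp
      then show ?thesis using Suc by (simp add: r2_def merge_def)
    qed (auto simp: r2_def)
    have sat_merge: "sat M ((merge f g)(0 := y)) \<phi> \<longleftrightarrow> sat M (f(0 := y)) \<phi>1 \<and> sat M (g(0 := y)) \<phi>2" for f g y
      by (simp only: \<phi>_def sat.simps sat_subst r1 r2)
    have "good \<phi> (merge e1 e2) (merge e1' e2')"
      unfolding good_def
    proof (intro conjI ballI impI)
      show "wf_fm M \<phi>" using 1 2 by (auto simp: \<phi>_def good_def r1_def r2_def intro!: wf_subst)
      show "params \<phi> = {}" using 1 2 by (auto simp: \<phi>_def good_def r1_def r2_def params_subst split: if_splits)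
      show "merge e1 e2 0 = x" by (simp add: merge_def)
      have "merge e1 e2 = (merge e1 e2)(0 := x)" "e1 = e1(0 := x)" "e2 = e2(0 := x)"
        using 1 2 by (auto simp: merge_def good_def)
      then show "sat M (merge e1 e2) \<phi>" using sat_merge[of e1 e2 x] 1 2 unfolding good_def by metis
      fix i assume i: "i \<in> fv \<phi>" "i \<noteq> 0"
      then consider k where "k \<in> fv \<phi>1" "i = 2 * k" | k where "k \<in> fv \<phi>2" "k > 0" "i = 2 * k - 1"
        by (auto simp: \<phi>_def fv_subst r1_def r2_def split: if_splits)
      then show "(merge e1 e2 i, merge e1' e2' i) \<in> R"
      proof cases
        case 1
        then show ?thesis using \<open>good \<phi>1 e1 e1'\<close> i by (auto simp: merge_def good_def)
      next
        case 2
        then obtain l where "k = Suc l" by (cases k) auto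
        then show ?thesis using \<open>good \<phi>2 e2 e2'\<close> 2 by (auto simp: merge_def good_def)
      qed
    qed
    moreover have "\<forall>\<psi>\<in>insert \<psi> F. sat M (\<lambda>_. y) \<psi>" if "sat M ((merge e1' e2')(0 := y)) \<phi>" for y
      using that 1(2)[of y] 2(2) by (auto simp: sat_merge sat_inst)
    ultimately show ?case by blast
  qed
  have "finitely_satisfiable M \<Phi>"
    unfolding finitely_satisfiable_def
  proof (intro allI impI)
    fix F assume "F \<subseteq> \<Phi>" "finite F"
    then obtain \<phi> e e' where *: "good \<phi> e e'"
      "\<And>y. sat M (e'(0 := y)) \<phi> \<Longrightarrow> \<forall>\<psi>\<in>F. sat M (\<lambda>_. y) \<psi>" using combine by metis
    have shift: "case_nat (f 0) (\<lambda>i. f (Suc i)) = f" for f :: "nat \<Rightarrow> 'm"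
      by (auto simp: fun_eq_iff split: nat.split)
    \<comment> \<open>Quantifying over variable 0 leaves a formula whose free variables take values
      paired by \<open>R\<close>. It transfers, and a witness on the other side satisfies
      \<open>F\<close>.\<close>
    have "sat M (\<lambda>i. e (Suc i)) (Ex \<phi>)"
      using * by (auto simp: good_def shift intro!: exI[of _ x] dest!: sym[of _ x])
    then have "sat M (\<lambda>i. e' (Suc i)) (Ex \<phi>)"
      using * elementaryD[OF R, of "Ex \<phi>" "\<lambda>i. e (Suc i)" "\<lambda>i. e' (Suc i)"] by (auto simp: good_def)
    then obtain y where "sat M (case_nat y (\<lambda>i. e' (Suc i))) \<phi>" by auto
    moreover have "case_nat y (\<lambda>i. e' (Suc i)) = e'(0 := y)" by (auto simp: fun_eq_iff split: nat.split)
    ultimately show "\<exists>e. realizes M e F" using * by (auto simp: realizes_def)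
  qed
  then obtain y where y: "realizes1 M y \<Phi>"
    using sat small \<open>\<Phi> \<subseteq> formulas M 1 (Range R)\<close> unfolding saturated_def by blast
  have "elementary M (insert (x, y) R)"
  proof (rule elementaryI)
    fix \<phi> :: "('f, 'r, 'm) fm" and e e'
    assume *: "wf_fm M \<phi>" "params \<phi> = {}" "\<And>i. i \<in> fv \<phi> \<Longrightarrow> (e i, e' i) \<in> insert (x, y) R" "sat M e \<phi>"
    \<comment> \<open>\<open>P\<close> marks the variables whose pair is not in \<open>R\<close> and
      is therefore \<open>(x, y)\<close>. They are all identified with variable 0 while the others
      move up by one, which makes the formula good.\<close>
    define P where "P = (\<lambda>i. i \<in> fv \<phi> \<and> (e i, e' i) \<notin> R)"
    define \<phi>' where "\<phi>' = subst (\<lambda>i. if P i then Var 0 else Var (Suc i)) \<phi>"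
    have P: "e i = x" "e' i = y" if "P i" for i using that *(3)[of i] by (auto simp: P_def)
    have fv': "fv \<phi>' \<subseteq> insert 0 (Suc ` {i \<in> fv \<phi>. \<not> P i})" by (auto simp: \<phi>'_def fv_subst split: if_splits)
    have "sat M (case_nat x e) \<phi>'"
      unfolding \<phi>'_def sat_subst using *(4) P by (subst sat_cong[where e' = e]) auto
    then have "good \<phi>' (case_nat x e) (case_nat y e')"
      using * fv' by (auto simp: good_def \<phi>'_def params_subst P_def intro!: wf_subst)
    then have "inst \<phi>' (case_nat y e') \<in> \<Phi>" by (auto simp: \<Phi>_def)
    then have "sat M ((case_nat y e')(0 := y)) \<phi>'" using y sat_inst[of "\<lambda>_. y"] by (auto simp: realizes_def)
    moreover have "(case_nat y e')(0 := y) = case_nat y e'" by (auto simp: fun_eq_iff)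
    ultimately have "sat M (case_nat y e') \<phi>'" by simp
    then show "sat M e' \<phi>"
      unfolding \<phi>'_def sat_subst using P by (subst sat_cong[where e' = "\<lambda>i. eval_tm M (case_nat y e') (if P i then Var 0 else Var (Suc i))"]) auto
  qed
  then show ?thesis ..
qed

text \<open>Equality makes \<open>R\<close> the graph of a bijection; the atomic formulas
  \<open>x0 = f(x1, ..., xn)\<close> and \<open>r(x1, ..., xn)\<close> make it respect the
  signature.\<close>

lemma automorphism_of_elementary:
  fixes M :: "('f, 'r, 'm) model"
  assumes R: "elementary M R" and "Domain R = UNIV" "Range R = UNIV"
  obtains \<sigma> where "automorphism M \<sigma>" "\<And>x y. (x, y) \<in> R \<longleftrightarrow> y = \<sigma> x"
proof -
  have eq: "x = x' \<longleftrightarrow> y = y'" if "(x, y) \<in> R" "(x', y') \<in> R" for x y x' y'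
  proof -
    have "sat M (case_nat x (\<lambda>_. x')) (Eq (Var 0) (Var 1)) \<longleftrightarrow> sat M (case_nat y (\<lambda>_. y')) (Eq (Var 0) (Var 1))"
      using that by (intro elementaryD[OF R]) auto
    then show ?thesis by simp
  qed
  have "\<forall>x. \<exists>y. (x, y) \<in> R" using assms(2) by blast
  then obtain \<sigma> where \<sigma>: "(x, \<sigma> x) \<in> R" for x by metis
  have R_eq: "(x, y) \<in> R \<longleftrightarrow> y = \<sigma> x" for x y
    using eq[OF _ \<sigma>[of x], of x y] \<sigma>[of x] by auto
  have "bij \<sigma>"
  proof (rule bijI')
    show "\<sigma> x = \<sigma> y \<longleftrightarrow> x = y" for x y using eq[OF \<sigma> \<sigma>] by blast
    show "\<exists>x. y = \<sigma> x" for y using assms(3) R_eq by (metis Range_iff UNIV_I)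
  qed
  \<comment> \<open>The arguments start at variable 1, since variable 0 holds the value of the
    function. Beyond the list \<open>asg\<close> repeats \<open>a\<close>, so that the pair at every
    index lies in \<open>R\<close>.\<close>
  define vars :: "nat \<Rightarrow> ('f, 'm) tm list" where "vars n = map (\<lambda>i. Var (Suc i)) [0..<n]" for n
  define asg where "asg a as = case_nat a (\<lambda>i. if i < length as then as ! i else a)" for a :: 'm and as
  have eval: "map (eval_tm M (asg a as)) (vars (length as)) = as" for a as
    by (rule nth_equalityI) (auto simp: asg_def vars_def)
  have map: "(asg a as i, asg (\<sigma> a) (map \<sigma> as) i) \<in> R" for a as i
    using \<sigma> by (auto simp: asg_def split: nat.split)
  have "\<sigma> (fint M f as) = fint M f (map \<sigma> as)" if "(f, length as) \<in> fsig M" for f as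
  proof -
    let ?\<phi> = "Eq (Var 0) (Fn f (vars (length as))) :: ('f, 'r, 'm) fm"
    have wf: "wf_fm M ?\<phi>" "params ?\<phi> = {}" using that by (auto simp: vars_def)
    have "sat M (asg (fint M f as) as) ?\<phi> \<longleftrightarrow> sat M (asg (\<sigma> (fint M f as)) (map \<sigma> as)) ?\<phi>"
      by (rule elementaryD[OF R wf map])
    then show ?thesis using eval[of _ as] eval[of _ "map \<sigma> as"] by (simp add: asg_def)
  qed
  moreover have "rint M r as = rint M r (map \<sigma> as)" if "(r, length as) \<in> rsig M" for r as
  proof -
    let ?\<phi> = "Rel r (vars (length as)) :: ('f, 'r, 'm) fm"
    have wf: "wf_fm M ?\<phi>" "params ?\<phi> = {}" using that by (auto simp: vars_def)
    have "sat M (asg undefined as) ?\<phi> \<longleftrightarrow> sat M (asg (\<sigma> undefined) (map \<sigma> as)) ?\<phi>"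
      by (rule elementaryD[OF R wf map])
    then show ?thesis using eval[of _ as] eval[of _ "map \<sigma> as"] by (simp add: asg_def)
  qed
  ultimately have "automorphism M \<sigma>" using \<open>bij \<sigma>\<close> unfolding automorphism_def by blast
  then show ?thesis using R_eq by (rule that)
qed

section \<open>Back-and-forth: extension to automorphisms of the whole model\<close>

lemma small_Un: "infinite (UNIV :: 'm set) \<Longrightarrow> small A \<Longrightarrow> small B \<Longrightarrow> small (A \<union> B :: 'm set)"
  unfolding small_def by (rule card_of_Un_ordLess_infinite)

lemma card_of_finite_less_infinite: "finite A \<Longrightarrow> infinite B \<Longrightarrow> |A| <o |B|"
  by (rule finite_ordLess_infinite[OF card_of_Well_order card_of_Well_order]) (simp_all add: Field_card_of)

lemma small_finite: "infinite (UNIV :: 'm set) \<Longrightarrow> finite B \<Longrightarrow> small (B :: 'm set)"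
  unfolding small_def by (rule card_of_finite_less_infinite)

text \<open>Back and forth along a well-order of the universe of type \<open>|UNIV|\<close>. Every
  proper initial segment has smaller cardinality, so the relation built before a stage is still
  small and \<open>elementary_extend\<close> applies to it.\<close>

lemma elementary_extends_to_automorphism:
  fixes M :: "('f, 'r, 'm) model"
  assumes sat: "saturated M" and inf: "infinite (UNIV :: 'm set)"
    and R0: "elementary M R0" and small_dom: "small (Domain R0)" and small_ran: "small (Range R0)"
  obtains \<sigma> where "automorphism M \<sigma>" "\<And>x y. (x, y) \<in> R0 \<Longrightarrow> \<sigma> x = y"
proof -
  define r where "r = |UNIV :: 'm set|"
  have wo: "Well_order r" "Card_order r" "Field r = UNIV" using card_of_Card_order card_of_Well_order by (auto simp: r_def Field_card_of)
  have wf: "wf (r - Id)" using wo(1) by (simp add: well_order_on_def)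
  define upto where "upto f x = R0 \<union> (\<Union>y\<in>underS r x. f y)" for f :: "'m \<Rightarrow> 'm rel" and x
  \<comment> \<open>\<open>G\<close> is the finite set of pairs added at stage \<open>x\<close>.
    Elementarity is demanded conditionally, so that a choice exists at every stage; the fact
    \<open>S\<close> below discharges the condition by induction.\<close>
  define P where "P f x G \<longleftrightarrow> (elementary M (upto f x) \<longrightarrow>
    elementary M (upto f x \<union> G)) \<and> x \<in> Domain G \<and> x \<in> Range G \<and> finite G" for f x G
  have "\<exists>f. \<forall>x. P f x (f x)"
  proof (rule dependent_wf_choice[OF wf])
    fix f g :: "'m \<Rightarrow> 'm rel" and x G
    assume "\<And>z. (z, x) \<in> r - Id \<Longrightarrow> f z = g z"
    then have "f z = g z" if "z \<in> underS r x" for z using that by (simp add: underS_def)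
    then have "upto f x = upto g x" by (simp add: upto_def)
    then show "P f x G = P g x G" by (simp add: P_def)
  next
    fix x and f :: "'m \<Rightarrow> 'm rel"
    assume IH: "\<And>y. (y, x) \<in> r - Id \<Longrightarrow> P f y (f y)"
    have fin: "finite (f y)" if "y \<in> underS r x" for y
      using IH[of y] that by (auto simp: P_def underS_def)
    have less: "|underS r x| <o |UNIV :: 'm set|"
      using card_of_underS[OF wo(2)] wo(3) by (simp add: r_def)
    \<comment> \<open>When \<open>|UNIV|\<close> is singular, a union of fewer than
      \<open>|UNIV|\<close> small sets may fail to be small. Here the sets are finite, so the union
      is finite or at most as large as its index set.\<close>
    have small_UN: "small (\<Union>y\<in>underS r x. g y)" if "\<And>y. y \<in> underS r x \<Longrightarrow> finite (g y)" for g :: "'m \<Rightarrow> 'm set"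
    proof (cases "finite (underS r x)")
      case True
      then show ?thesis using that inf by (intro small_finite) auto
    next
      case False
      have "|g y| \<le>o |underS r x|" if "y \<in> underS r x" for y
        using card_of_finite_less_infinite[of "g y" "underS r x"] \<open>\<And>y. y \<in> underS r x \<Longrightarrow> finite (g y)\<close>[OF that] False
        by (simp add: ordLess_imp_ordLeq)
      then have "|\<Union>y\<in>underS r x. g y| \<le>o |underS r x|"
        using card_of_UNION_ordLeq_infinite[OF False ordIso_imp_ordLeq[OF card_of_refl]] by blast
      then show ?thesis using less unfolding small_def by (rule ordLeq_ordLess_trans)
    qed
    have "Domain (upto f x) = Domain R0 \<union> (\<Union>y\<in>underS r x. Domain (f y))"
      "Range (upto f x) = Range R0 \<union> (\<Union>y\<in>underS r x. Range (f y))" by (auto simp: upto_def)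
    then have small: "small (Domain (upto f x))" "small (Range (upto f x))"
      using small_dom small_ran fin inf by (auto intro!: small_Un small_UN finite_Domain finite_Range)
    show "\<exists>G. P f x G"
    proof (cases "elementary M (upto f x)")
      case False
      \<comment> \<open>A default value; by the fact \<open>S\<close> below the relation before a
        stage of the finished construction is elementary.\<close>
      then show ?thesis by (auto simp: P_def intro!: exI[of _ "{(x, x)}"])
    next
      case True
      then obtain y where y: "elementary M (insert (x, y) (upto f x))"
        using elementary_extend[OF sat True small(2)] by blast
      \<comment> \<open>The back step, obtained as a forth step for the converse relation.\<close>
      have "Range ((insert (x, y) (upto f x))\<inverse>) = insert x (Domain (upto f x))" by auto
      moreover have "small (insert x (Domain (upto f x)))"
        using small_Un[OF inf small_finite[OF inf, of "{x}"] small(1)] by simp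
      ultimately obtain z where z: "elementary M (insert (x, z) ((insert (x, y) (upto f x))\<inverse>))"
        using elementary_extend[OF sat elementary_converse[OF y]] by metis
      have "(insert (x, z) ((insert (x, y) (upto f x))\<inverse>))\<inverse> = upto f x \<union> {(x, y), (z, x)}" by auto
      then have "P f x {(x, y), (z, x)}"
        using elementary_converse[OF z] by (auto simp: P_def)
      then show ?thesis ..
    qed
  qed
  then obtain f where f: "P f x (f x)" for x by blast
  define S where "S x = upto f x \<union> f x" for x
  have r: "trans r" "antisym r" "total r" "refl r"
    using wo by (simp_all add: order_on_defs refl_on_def)
  have S_mono: "S x \<subseteq> S y" if "(x, y) \<in> r" for x y
    using underS_incr[OF r(1,2) that] that by (auto simp: S_def upto_def underS_def)
  have union: "elementary M (R0 \<union> (\<Union>y\<in>Y. f y))" if "\<And>y. y \<in> Y \<Longrightarrow> elementary M (S y)" for Y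
  proof -
    have "S x \<subseteq> S y \<or> S y \<subseteq> S x" for x y
      using r S_mono by (metis UNIV_I total_on_def refl_on_def)
    moreover have R0_S: "R0 \<subseteq> S y" for y by (auto simp: S_def upto_def)
    ultimately have "subset.chain UNIV (insert R0 (S ` Y))" unfolding subset.chain_def by blast
    then have "elementary M (\<Union>(insert R0 (S ` Y)))"
      using R0 that by (intro elementary_chain) auto
    then show ?thesis by (rule elementary_mono) (auto simp: S_def)
  qed
  have S: "elementary M (S x)" for x
  proof (induction x rule: wf_induct_rule[OF wf])
    case (1 x)
    then have "elementary M (upto f x)" unfolding upto_def by (intro union) (simp add: underS_def)
    then show ?case using f[of x] by (simp add: P_def S_def)
  qed
  define R where "R = R0 \<union> (\<Union>x. f x)"
  have "elementary M R" unfolding R_def by (rule union) (rule S)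
  moreover have "Domain R = UNIV" "Range R = UNIV" using f unfolding P_def R_def by blast+
  ultimately obtain \<sigma> where \<sigma>: "automorphism M \<sigma>" "\<And>x y. (x, y) \<in> R \<longleftrightarrow> y = \<sigma> x"
    using automorphism_of_elementary by blast
  have "\<sigma> x = y" if "(x, y) \<in> R0" for x y using \<sigma>(2)[of x y] that by (simp add: R_def)
  with \<sigma>(1) show ?thesis by (rule that)
qed

text \<open>The identity on \<open>B\<close> together with the pairs \<open>(e i, e' i)\<close> is
  elementary: a parameter-free formula evaluated at such pairs amounts to a formula over
  \<open>B\<close> in the first \<open>n\<close> variables.\<close>

lemma homogeneous:
  fixes M :: "('f, 'r, 'm) model"
  assumes sat: "saturated M" and inf: "infinite (UNIV :: 'm set)" and B: "small B"
    and same: "\<And>\<theta>. \<theta> \<in> formulas M n B \<Longrightarrow> sat M e \<theta> \<longleftrightarrow> sat M e' \<theta>"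
  obtains \<sigma> where "automorphism M \<sigma>" "\<And>b. b \<in> B \<Longrightarrow> \<sigma> b = b" "\<And>i. i < n \<Longrightarrow> \<sigma> (e i) = e' i"
proof -
  define R where "R = Id_on B \<union> (\<lambda>i. (e i, e' i)) ` {..<n}"
  have "elementary M R"
  proof (rule elementaryI)
    fix \<phi> :: "('f, 'r, 'm) fm" and d d'
    assume *: "wf_fm M \<phi>" "params \<phi> = {}" "\<And>i. i \<in> fv \<phi> \<Longrightarrow> (d i, d' i) \<in> R" "sat M d \<phi>"
    \<comment> \<open>Each free variable becomes an element of \<open>B\<close> or one of the first
      \<open>n\<close> variables with the same pair of values. \<open>SOME\<close> picks the index,
      as the tuples may have repetitions.\<close>
    define s :: "nat \<Rightarrow> ('f, 'm) tm" where
      "s i = (if d i \<in> B \<and> d i = d' i then Par (d i) else Var (SOME j. j < n \<and> d i = e j \<and> d' i = e' j))" for i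
    have s: "s i = Par (d i) \<and> d i \<in> B \<and> d i = d' i \<or> (\<exists>j<n. s i = Var j \<and> d i = e j \<and> d' i = e' j)"
      if "i \<in> fv \<phi>" for i
    proof (cases "d i \<in> B \<and> d i = d' i")
      case False
      then have "\<exists>j. j < n \<and> d i = e j \<and> d' i = e' j" using *(3)[OF that] by (auto simp: R_def)
      from someI_ex[OF this] show ?thesis using False unfolding s_def by auto
    qed (auto simp: s_def)
    have "subst s \<phi> \<in> formulas M n B"
      unfolding formulas_def mem_Collect_eq fv_subst params_subst
    proof (intro conjI wf_subst)
      show "wf_tm M (s i)" if "i \<in> fv \<phi>" for i using s[OF that] by auto
      show "(\<Union>i\<in>fv \<phi>. fv_tm (s i)) \<subseteq> {..<n}" using s by fastforce
      show "params \<phi> \<union> (\<Union>i\<in>fv \<phi>. params_tm (s i)) \<subseteq> B" using s * by fastforce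
    qed fact
    moreover have "sat M e (subst s \<phi>) \<longleftrightarrow> sat M d \<phi>"
      unfolding sat_subst by (rule sat_cong) (use s in fastforce)
    moreover have "sat M e' (subst s \<phi>) \<longleftrightarrow> sat M d' \<phi>"
      unfolding sat_subst by (rule sat_cong) (use s in fastforce)
    ultimately show "sat M d' \<phi>" using same * by blast
  qed
  moreover have "small (Domain R)" "small (Range R)"
  proof -
    have "Domain R = B \<union> e ` {..<n}" "Range R = B \<union> e' ` {..<n}" by (auto simp: R_def)
    then show "small (Domain R)" "small (Range R)" using small_Un[OF inf B small_finite[OF inf]] by simp_all
  qed
  ultimately obtain \<sigma> where "automorphism M \<sigma>" "\<And>x y. (x, y) \<in> R \<Longrightarrow> \<sigma> x = y"
    using elementary_extends_to_automorphism[OF sat inf] by blast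
  then show ?thesis by (intro that[of \<sigma>]) (auto simp: R_def)
qed

section \<open>Definable sets and binary relations\<close>

definition definable_set :: "('f, 'r, 'm) model \<Rightarrow> 'm set \<Rightarrow> 'm set \<Rightarrow> bool" where
  "definable_set M B S \<longleftrightarrow> (\<exists>\<phi>\<in>formulas M 1 B. \<forall>x. x \<in> S \<longleftrightarrow> sat M (\<lambda>_. x) \<phi>)"

text \<open>Predicates in place of formulas keep substitutions out of the later arguments. The
  assignment \<open>case_nat x (\<lambda>_. y)\<close> has value \<open>y\<close> from index 1 on,
  and a formula in two variables sees indices 0 and 1.\<close>

definition definable_rel :: "('f, 'r, 'm) model \<Rightarrow> 'm set \<Rightarrow> ('m \<Rightarrow> 'm \<Rightarrow> bool) \<Rightarrow> bool" where
  "definable_rel M B T \<longleftrightarrow> (\<exists>\<phi>\<in>formulas M 2 B. \<forall>x y. T x y \<longleftrightarrow> sat M (case_nat x (\<lambda>_. y)) \<phi>)"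

lemma formulas_mono: "\<phi> \<in> formulas M n B \<Longrightarrow> B \<subseteq> B' \<Longrightarrow> \<phi> \<in> formulas M n B'"
  unfolding formulas_def by blast

lemma definable_rel_mono: "definable_rel M B T \<Longrightarrow> B \<subseteq> B' \<Longrightarrow> definable_rel M B' T"
  unfolding definable_rel_def using formulas_mono by blast

lemma definable_rel_finite:
  assumes "definable_rel M B T"
  shows "\<exists>F. finite F \<and> F \<subseteq> B \<and> definable_rel M F T"
proof -
  from assms obtain \<phi> where \<phi>: "\<phi> \<in> formulas M 2 B" "\<forall>x y. T x y \<longleftrightarrow> sat M (case_nat x (\<lambda>_. y)) \<phi>"
    unfolding definable_rel_def by blast
  moreover from \<phi> have "\<phi> \<in> formulas M 2 (params \<phi>)" "params \<phi> \<subseteq> B" by (auto simp: formulas_def)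
  ultimately show ?thesis
    unfolding definable_rel_def using finite_params[of \<phi>] by blast
qed

lemma definable_set_finite:
  assumes "definable_set M B S"
  shows "\<exists>F. finite F \<and> F \<subseteq> B \<and> definable_set M F S"
proof -
  from assms obtain \<phi> where \<phi>: "\<phi> \<in> formulas M 1 B" "\<forall>x. x \<in> S \<longleftrightarrow> sat M (\<lambda>_. x) \<phi>"
    unfolding definable_set_def by blast
  moreover from \<phi> have "\<phi> \<in> formulas M 1 (params \<phi>)" "params \<phi> \<subseteq> B" by (auto simp: formulas_def)
  ultimately show ?thesis
    unfolding definable_set_def using finite_params[of \<phi>] by blast
qed

lemma definable_set_Compl: "definable_set M B S \<Longrightarrow> definable_set M B (- S)"
proof -
  assume "definable_set M B S"
  then obtain \<phi> where \<phi>: "\<phi> \<in> formulas M 1 B" "\<forall>x. x \<in> S \<longleftrightarrow> sat M (\<lambda>_. x) \<phi>"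
    unfolding definable_set_def by blast
  then have "Neg \<phi> \<in> formulas M 1 B" by (auto simp: formulas_def)
  with \<phi> show ?thesis unfolding definable_set_def by (auto intro!: bexI[of _ "Neg \<phi>"])
qed

lemma definable_rel_restrict:
  assumes "definable_rel M B T" and "definable_set M B S"
  shows "definable_rel M B (\<lambda>x y. x \<in> S \<and> T x y)"
proof -
  from assms obtain \<phi> \<theta> where "\<phi> \<in> formulas M 2 B" "\<forall>x y. T x y \<longleftrightarrow> sat M (case_nat x (\<lambda>_. y)) \<phi>"
    and \<theta>: "\<theta> \<in> formulas M 1 B" "\<forall>x. x \<in> S \<longleftrightarrow> sat M (\<lambda>_. x) \<theta>"
    unfolding definable_rel_def definable_set_def by blast
  moreover have "sat M (case_nat x (\<lambda>_. y)) \<theta> \<longleftrightarrow> sat M (\<lambda>_. x) \<theta>" for x y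
    using \<theta>(1) by (rule sat_cong_formulas) auto
  moreover have "Conj \<theta> \<phi> \<in> formulas M 2 B" using calculation by (auto simp: formulas_def)
  ultimately show ?thesis unfolding definable_rel_def by (auto intro!: bexI[of _ "Conj \<theta> \<phi>"])
qed

lemma definable_rel_Not:
  assumes "definable_rel M B T"
  shows "definable_rel M B (\<lambda>x y. \<not> T x y)"
proof -
  from assms obtain \<phi> where \<phi>: "\<phi> \<in> formulas M 2 B" "\<forall>x y. T x y \<longleftrightarrow> sat M (case_nat x (\<lambda>_. y)) \<phi>"
    unfolding definable_rel_def by blast
  then have "Neg \<phi> \<in> formulas M 2 B" by (auto simp: formulas_def)
  with \<phi> show ?thesis unfolding definable_rel_def by (auto intro!: bexI[of _ "Neg \<phi>"])
qed

lemma definable_rel_swap: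
  assumes "definable_rel M B T"
  shows "definable_rel M B (\<lambda>x y. T y x)"
proof -
  from assms obtain \<phi> where \<phi>: "\<phi> \<in> formulas M 2 B" "\<forall>x y. T x y \<longleftrightarrow> sat M (case_nat x (\<lambda>_. y)) \<phi>"
    unfolding definable_rel_def by blast
  let ?\<psi> = "subst (\<lambda>i. if i = 0 then Var 1 else Var 0) \<phi>"
  have "?\<psi> \<in> formulas M 2 B"
    using \<phi> by (auto simp: formulas_def fv_subst params_subst intro!: wf_subst split: if_splits)
  moreover have "T y x \<longleftrightarrow> sat M (case_nat x (\<lambda>_. y)) ?\<psi>" for x y
    unfolding sat_subst \<phi>(2)[rule_format] using \<phi>(1) by (rule sat_cong_formulas) (auto split: nat.split)
  ultimately show ?thesis unfolding definable_rel_def by blast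
qed

lemma definable_rel_section:
  assumes "definable_rel M B T"
  shows "definable_set M (insert b B) {x. T x b}"
proof -
  from assms obtain \<phi> where \<phi>: "\<phi> \<in> formulas M 2 B" "\<forall>x y. T x y \<longleftrightarrow> sat M (case_nat x (\<lambda>_. y)) \<phi>"
    unfolding definable_rel_def by blast
  let ?\<psi> = "subst (\<lambda>i. if i = 0 then Var 0 else Par b) \<phi>"
  have "?\<psi> \<in> formulas M 1 (insert b B)"
    using \<phi> by (auto simp: formulas_def fv_subst params_subst intro!: wf_subst split: if_splits)
  moreover have "T x b \<longleftrightarrow> sat M (\<lambda>_. x) ?\<psi>" for x
    unfolding sat_subst \<phi>(2)[rule_format] using \<phi>(1) by (rule sat_cong_formulas) (auto split: nat.split)
  ultimately show ?thesis unfolding definable_set_def by blast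
qed

text \<open>Abstracting \<open>b\<close> into variable 1 separates it from the base
  \<open>B\<close>, so that \<open>b\<close> can later be replaced by a conjugate.\<close>

lemma definable_set_as_section:
  assumes "definable_set M (insert b B) S"
  obtains T where "definable_rel M B T" "\<And>x. x \<in> S \<longleftrightarrow> T x b"
proof -
  from assms obtain \<phi> where \<phi>: "\<phi> \<in> formulas M 1 (insert b B)" "\<forall>x. x \<in> S \<longleftrightarrow> sat M (\<lambda>_. x) \<phi>"
    unfolding definable_set_def by blast
  let ?\<psi> = "abstract b 1 \<phi>"
  have "fv ?\<psi> \<subseteq> {..<2}" using \<phi>(1) fv_abstract[of b 1 \<phi>] by (force simp: formulas_def)
  then have "?\<psi> \<in> formulas M 2 B"
    using \<phi>(1) by (auto simp: formulas_def params_abstract wf_abstract)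
  then have "definable_rel M B (\<lambda>x y. sat M (case_nat x (\<lambda>_. y)) ?\<psi>)"
    unfolding definable_rel_def by blast
  moreover have "x \<in> S \<longleftrightarrow> sat M (case_nat x (\<lambda>_. b)) ?\<psi>" for x
    unfolding \<phi>(2)[rule_format] by (subst sat_abstract) (auto intro!: sat_cong_formulas[OF \<phi>(1)])
  ultimately show ?thesis by (rule that)
qed

lemma definable_rel_fibre_inclusion:
  assumes "definable_rel M B T"
  shows "definable_rel M B (\<lambda>x y. \<forall>z. T z x \<longrightarrow> T z y)"
proof -
  from assms obtain \<phi> where \<phi>: "\<phi> \<in> formulas M 2 B" "\<forall>x y. T x y \<longleftrightarrow> sat M (case_nat x (\<lambda>_. y)) \<phi>"
    unfolding definable_rel_def by blast
  \<comment> \<open>Under the quantifier index 0 is \<open>z\<close>, so \<open>x\<close> and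
    \<open>y\<close> have indices 1 and 2.\<close>
  define \<phi>1 where "\<phi>1 = subst (\<lambda>i. if i = 0 then Var 0 else Var 1) \<phi>"
  define \<phi>2 where "\<phi>2 = subst (\<lambda>i. if i = 0 then Var 0 else Var 2) \<phi>"
  have "\<phi>1 \<in> formulas M 3 B" "\<phi>2 \<in> formulas M 3 B"
    using \<phi> by (auto simp: formulas_def \<phi>1_def \<phi>2_def fv_subst params_subst intro!: wf_subst split: if_splits)
  then have "Neg (Ex (Conj \<phi>1 (Neg \<phi>2))) \<in> formulas M 2 B" by (auto simp: formulas_def)
  moreover have "sat M (case_nat z (case_nat x (\<lambda>_. y))) \<phi>1 \<longleftrightarrow> T z x" for x y z
    unfolding \<phi>1_def sat_subst \<phi>(2)[rule_format] using \<phi>(1) by (rule sat_cong_formulas) (auto split: nat.split)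
  moreover have "sat M (case_nat z (case_nat x (\<lambda>_. y))) \<phi>2 \<longleftrightarrow> T z y" for x y z
    unfolding \<phi>2_def sat_subst \<phi>(2)[rule_format] using \<phi>(1)
    by (rule sat_cong_formulas) (auto simp: numeral_2_eq_2 split: nat.split)
  ultimately show ?thesis
    unfolding definable_rel_def by (intro bexI[of _ "Neg (Ex (Conj \<phi>1 (Neg \<phi>2)))"]) auto
qed

text \<open>This makes a partial order out of a quasi-order \<open>T\<close> without changing its
  strict part.\<close>

lemma definable_rel_strict_or_eq:
  assumes "definable_rel M B T"
  shows "definable_rel M B (\<lambda>x y. x = y \<or> (T x y \<and> \<not> T y x))"
proof -
  from assms definable_rel_swap[OF assms] obtain \<phi> \<psi> where
    "\<phi> \<in> formulas M 2 B" "\<forall>x y. T x y \<longleftrightarrow> sat M (case_nat x (\<lambda>_. y)) \<phi>"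
    "\<psi> \<in> formulas M 2 B" "\<forall>x y. T y x \<longleftrightarrow> sat M (case_nat x (\<lambda>_. y)) \<psi>"
    unfolding definable_rel_def by blast
  then show ?thesis
    unfolding definable_rel_def
    by (intro bexI[of _ "Neg (Conj (Neg (Eq (Var 0) (Var 1))) (Neg (Conj \<phi> (Neg \<psi>))))"]) (auto simp: formulas_def)
qed

lemma definable_rel_automorphism:
  assumes "definable_rel M B T" and "automorphism M \<sigma>" and "\<And>b. b \<in> B \<Longrightarrow> \<sigma> b = b"
  shows "T (\<sigma> x) (\<sigma> y) \<longleftrightarrow> T x y"
proof -
  from assms obtain \<phi> where \<phi>: "\<phi> \<in> formulas M 2 B" "\<forall>x y. T x y \<longleftrightarrow> sat M (case_nat x (\<lambda>_. y)) \<phi>"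
    unfolding definable_rel_def by blast
  have "map_fm \<sigma> \<phi> = map_fm id \<phi>" using \<phi>(1) assms(3) by (intro fm.map_cong) (auto simp: formulas_def)
  then have "map_fm \<sigma> \<phi> = \<phi>" by (simp add: fm.map_id)
  moreover have "(\<lambda>i. \<sigma> (case_nat x (\<lambda>_. y) i)) = case_nat (\<sigma> x) (\<lambda>_. \<sigma> y)"
    by (auto simp: fun_eq_iff split: nat.split)
  ultimately show ?thesis
    using sat_automorphism[OF assms(2), of \<phi> "case_nat x (\<lambda>_. y)"] \<phi> by (simp add: formulas_def)
qed

section \<open>Generic elements of an invariant type\<close>

locale invariant_type =
  fixes M :: "('f, 'r, 'm) model" and A :: "'m set" and p :: "('f, 'r, 'm) fm set"
  assumes saturated: "saturated M" and small_base: "small A" and global_type: "global_type M p"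
    and invariant: "invariant_over M A p" and nonalgebraic: "nonalgebraic M p"
begin

text \<open>The filter generated by the sets that members of \<open>p\<close> define. On definable
  sets it behaves as an ultrafilter, which allows \<open>p\<close> to be handled through
  sets.\<close>

definition generically :: "'m set \<Rightarrow> bool" where
  "generically S \<longleftrightarrow> (\<exists>\<phi>\<in>p. \<forall>x. sat M (\<lambda>_. x) \<phi> \<longrightarrow> x \<in> S)"

abbreviation generic :: "'m \<Rightarrow> 'm set \<Rightarrow> bool" where
  "generic a B \<equiv> realizes1 M a (tp_restrict p B)"

lemma type_formulas: "p \<subseteq> formulas M 1 UNIV"
  using global_type by (simp add: complete_type_def)

lemma type_finitely_satisfied:
  assumes "F \<subseteq> p" "finite F"
  obtains x where "\<And>\<phi>. \<phi> \<in> F \<Longrightarrow> sat M (\<lambda>_. x) \<phi>"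
proof -
  obtain e where e: "\<And>\<phi>. \<phi> \<in> F \<Longrightarrow> sat M e \<phi>"
    using global_type assms unfolding complete_type_def finitely_satisfiable_def realizes_def by meson
  have "sat M (\<lambda>_. e 0) \<phi>" if "\<phi> \<in> F" for \<phi>
  proof -
    have "\<phi> \<in> formulas M 1 UNIV" using that assms type_formulas by blast
    then have "sat M (\<lambda>_. e 0) \<phi> \<longleftrightarrow> sat M e \<phi>" by (rule sat_cong_formulas) simp
    with e[OF that] show ?thesis by simp
  qed
  then show ?thesis by (rule that)
qed

lemma type_complete: "\<phi> \<in> formulas M 1 UNIV \<Longrightarrow> \<phi> \<in> p \<or> Neg \<phi> \<in> p"
  using global_type unfolding complete_type_def by blast

text \<open>Otherwise completeness would put \<open>Neg \<phi>\<close> into \<open>p\<close>, and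
  together with \<open>F\<close> it would contradict finite satisfiability.\<close>

lemma type_upward:
  assumes "\<phi> \<in> formulas M 1 UNIV" "F \<subseteq> p" "finite F"
    and "\<And>x. (\<And>\<psi>. \<psi> \<in> F \<Longrightarrow> sat M (\<lambda>_. x) \<psi>) \<Longrightarrow> sat M (\<lambda>_. x) \<phi>"
  shows "\<phi> \<in> p"
proof (rule ccontr)
  assume "\<phi> \<notin> p"
  then have "insert (Neg \<phi>) F \<subseteq> p" "finite (insert (Neg \<phi>) F)" using assms type_complete by auto
  then obtain x where x: "\<And>\<psi>. \<psi> \<in> insert (Neg \<phi>) F \<Longrightarrow> sat M (\<lambda>_. x) \<psi>"
    using type_finitely_satisfied by blast
  then have "sat M (\<lambda>_. x) \<phi>" by (intro assms(4)) blast
  with x[of "Neg \<phi>"] show False by simp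
qed

lemma in_type_iff_generically:
  assumes "\<phi> \<in> formulas M 1 UNIV"
  shows "\<phi> \<in> p \<longleftrightarrow> generically {x. sat M (\<lambda>_. x) \<phi>}"
  unfolding generically_def using type_upward[OF assms, of "{_}"] by auto

lemma generically_mono: "generically S \<Longrightarrow> S \<subseteq> T \<Longrightarrow> generically T"
  unfolding generically_def by blast

lemma generically_Int:
  assumes "generically S" "generically T"
  shows "generically (S \<inter> T)"
proof -
  from assms obtain \<phi> \<psi> where *: "\<phi> \<in> p" "\<psi> \<in> p" "\<forall>x. sat M (\<lambda>_. x) \<phi> \<longrightarrow> x \<in> S" "\<forall>x. sat M (\<lambda>_. x) \<psi> \<longrightarrow> x \<in> T"
    unfolding generically_def by blast
  moreover have "Conj \<phi> \<psi> \<in> p"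
    using * type_formulas by (intro type_upward[of _ "{\<phi>, \<psi>}"]) (auto simp: formulas_def)
  ultimately show ?thesis unfolding generically_def by (intro bexI[of _ "Conj \<phi> \<psi>"]) auto
qed

lemma generically_infinite:
  assumes "generically S"
  shows "infinite S"
proof -
  obtain \<phi> where "\<phi> \<in> p" "{x. sat M (\<lambda>_. x) \<phi>} \<subseteq> S" using assms unfolding generically_def by blast
  then show ?thesis using nonalgebraic infinite_super unfolding nonalgebraic_def by blast
qed

lemma generically_Compl:
  assumes "definable_set M B S"
  shows "generically (- S) \<longleftrightarrow> \<not> generically S"
proof
  show "generically (- S) \<Longrightarrow> \<not> generically S"
    using generically_Int[of S "- S"] generically_infinite by fastforce
  obtain \<phi> where \<phi>: "\<phi> \<in> formulas M 1 B" "\<forall>x. x \<in> S \<longleftrightarrow> sat M (\<lambda>_. x) \<phi>"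
    using assms unfolding definable_set_def by blast
  then have "\<phi> \<in> p \<or> Neg \<phi> \<in> p" using type_complete formulas_mono by blast
  then show "\<not> generically S \<Longrightarrow> generically (- S)"
    using \<phi>(2) unfolding generically_def by (metis ComplI sat.simps(3))
qed

lemma generic_iff:
  "generic a B \<longleftrightarrow> (\<forall>S. definable_set M B S \<longrightarrow> generically S \<longrightarrow> a \<in> S)"
proof (intro iffI allI impI)
  fix S assume *: "generic a B" "definable_set M B S" "generically S"
  then obtain \<phi> where \<phi>: "\<phi> \<in> formulas M 1 B" "\<forall>x. x \<in> S \<longleftrightarrow> sat M (\<lambda>_. x) \<phi>"
    unfolding definable_set_def by blast
  then have "S = {x. sat M (\<lambda>_. x) \<phi>}" by blast
  then have "\<phi> \<in> p" using in_type_iff_generically[of \<phi>] formulas_mono[OF \<phi>(1)] * by blast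
  then have "\<phi> \<in> tp_restrict p B" using \<phi> by (auto simp: tp_restrict_def formulas_def)
  with * \<phi> show "a \<in> S" by (auto simp: realizes_def)
next
  assume *: "\<forall>S. definable_set M B S \<longrightarrow> generically S \<longrightarrow> a \<in> S"
  show "generic a B"
    unfolding realizes_def
  proof
    fix \<phi> assume "\<phi> \<in> tp_restrict p B"
    then have \<phi>: "\<phi> \<in> p" "\<phi> \<in> formulas M 1 B" using type_formulas by (auto simp: tp_restrict_def formulas_def)
    then have "definable_set M B {x. sat M (\<lambda>_. x) \<phi>}" "generically {x. sat M (\<lambda>_. x) \<phi>}"
      unfolding definable_set_def generically_def by blast+
    with * show "sat M (\<lambda>_. a) \<phi>" by blast
  qed
qed

text \<open>Either \<open>S\<close> or its complement belongs to the filter, and a generic element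
  lies in whichever does.\<close>

lemma generic_mem_iff:
  "generic a B \<Longrightarrow> definable_set M B S \<Longrightarrow> a \<in> S \<longleftrightarrow> generically S"
  using generically_Compl[of B S] definable_set_Compl[of M B S] generic_iff[of a B] by (meson ComplD)

lemma generic_mono: "generic a B' \<Longrightarrow> B \<subseteq> B' \<Longrightarrow> generic a B"
  unfolding realizes_def tp_restrict_def by blast

text \<open>Each formula of \<open>p|B\<close> has finitely many parameters.\<close>

lemma generic_finite_character:
  assumes "\<And>F. finite F \<Longrightarrow> F \<subseteq> B \<Longrightarrow> generic a F"
  shows "generic a B"
  unfolding generic_iff
proof (intro allI impI)
  fix S assume S: "definable_set M B S" "generically S"
  from definable_set_finite[OF S(1)] obtain F where F: "finite F" "F \<subseteq> B" "definable_set M F S" by auto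
  then have "generic a F" using assms by blast
  then show "a \<in> S" using F(3) S(2) unfolding generic_iff by blast
qed

lemma infinite_UNIV: "infinite (UNIV :: 'm set)"
proof -
  have "Eq (Var 0) (Var 0) \<in> p" using type_upward[of "Eq (Var 0) (Var 0)" "{}"] by (simp add: formulas_def)
  then show ?thesis using nonalgebraic unfolding nonalgebraic_def by fastforce
qed

lemma small_extension: "finite F \<Longrightarrow> small (A \<union> F)"
  using small_Un[OF infinite_UNIV small_base small_finite[OF infinite_UNIV]] .

lemma generic_exists:
  assumes "small B"
  shows "\<exists>a. generic a B"
proof -
  have "tp_restrict p B \<subseteq> p" by (auto simp: tp_restrict_def)
  moreover have "finitely_satisfiable M p" using global_type by (simp add: complete_type_def)
  ultimately have "finitely_satisfiable M (tp_restrict p B)"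
    unfolding finitely_satisfiable_def by (meson subset_trans)
  moreover have "tp_restrict p B \<subseteq> formulas M 1 B"
    using type_formulas by (auto simp: tp_restrict_def formulas_def)
  ultimately show ?thesis using saturated assms unfolding saturated_def by metis
qed

text \<open>An element of \<open>B\<close> is isolated by the algebraic formula \<open>x = a\<close>
  over \<open>B\<close>.\<close>

lemma generic_not_mem:
  assumes "generic a B"
  shows "a \<notin> B"
proof
  assume "a \<in> B"
  then have "definable_set M B {a}"
    unfolding definable_set_def by (intro bexI[of _ "Eq (Var 0) (Par a)"]) (auto simp: formulas_def)
  then have "generically {a}" using assms generic_mem_iff by blast
  then show False using generically_infinite by blast
qed

lemma not_genericE:
  assumes "\<not> generic a B"
  obtains S where "definable_set M B S" "a \<in> S" "\<not> generically S"
proof -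
  obtain S where "definable_set M B S" "generically S" "a \<notin> S" using assms unfolding generic_iff by blast
  then show ?thesis using that[of "- S"] definable_set_Compl[of M B S] generically_Compl[of B S] by simp
qed

section \<open>Invariance and conjugation\<close>

lemma type_automorphism:
  assumes "automorphism M \<sigma>" "\<And>a. a \<in> A \<Longrightarrow> \<sigma> a = a"
  shows "map_fm \<sigma> ` p = p"
  using invariant assms unfolding invariant_over_def by blast

lemma generic_automorphism:
  assumes \<sigma>: "automorphism M \<sigma>" "\<And>a. a \<in> A \<Longrightarrow> \<sigma> a = a" and a: "generic a B"
  shows "generic (\<sigma> a) (\<sigma> ` B)"
  unfolding realizes_def
proof
  fix \<phi> assume "\<phi> \<in> tp_restrict p (\<sigma> ` B)"
  then have "\<phi> \<in> map_fm \<sigma> ` p" "params \<phi> \<subseteq> \<sigma> ` B"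
    using type_automorphism[OF \<sigma>] by (simp_all add: tp_restrict_def)
  then obtain \<psi> where \<psi>: "\<psi> \<in> p" "\<phi> = map_fm \<sigma> \<psi>" "\<sigma> ` params \<psi> \<subseteq> \<sigma> ` B"
    by (auto simp: fm.set_map)
  moreover have "inj \<sigma>" using \<sigma> by (simp add: automorphism_def bij_is_inj)
  ultimately have "\<psi> \<in> tp_restrict p B" by (auto simp: tp_restrict_def inj_image_subset_iff)
  then have "sat M (\<lambda>_. a) \<psi>" using a by (auto simp: realizes_def)
  moreover have "wf_fm M \<psi>" using \<psi>(1) type_formulas by (auto simp: formulas_def)
  ultimately show "sat M (\<lambda>_. \<sigma> a) \<phi>" using sat_automorphism[OF \<sigma>(1), of \<psi> "\<lambda>_. a"] \<psi>(2) by simp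
qed

lemma generically_automorphism:
  assumes \<sigma>: "automorphism M \<sigma>" "\<And>a. a \<in> A \<Longrightarrow> \<sigma> a = a" and S: "generically S"
  shows "generically (\<sigma> ` S)"
proof -
  obtain \<phi> where \<phi>: "\<phi> \<in> p" "\<And>x. sat M (\<lambda>_. x) \<phi> \<Longrightarrow> x \<in> S" using S unfolding generically_def by blast
  have "map_fm \<sigma> \<phi> \<in> p" using \<phi>(1) type_automorphism[OF \<sigma>] by blast
  moreover have "x \<in> \<sigma> ` S" if "sat M (\<lambda>_. x) (map_fm \<sigma> \<phi>)" for x
  proof -
    obtain y where y: "x = \<sigma> y" using \<sigma>(1) unfolding automorphism_def by (blast elim: bij_pointE)
    have "wf_fm M \<phi>" using \<phi>(1) type_formulas by (auto simp: formulas_def)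
    then show ?thesis using that sat_automorphism[OF \<sigma>(1), of \<phi> "\<lambda>_. y"] \<phi>(2) y by auto
  qed
  ultimately show ?thesis unfolding generically_def by blast
qed

lemma generic_conjugate:
  assumes "small B" "generic a B" "generic b B"
  obtains \<sigma> where "automorphism M \<sigma>" "\<And>c. c \<in> B \<Longrightarrow> \<sigma> c = c" "\<sigma> a = b"
proof -
  have "sat M (\<lambda>_. a) \<theta> \<longleftrightarrow> sat M (\<lambda>_. b) \<theta>" if "\<theta> \<in> formulas M 1 B" for \<theta>
  proof -
    have "definable_set M B {x. sat M (\<lambda>_. x) \<theta>}" using that unfolding definable_set_def by blast
    then show ?thesis using generic_mem_iff[OF assms(2)] generic_mem_iff[OF assms(3)] by blast
  qed
  then obtain \<sigma> where \<sigma>: "automorphism M \<sigma>" "\<And>c. c \<in> B \<Longrightarrow> \<sigma> c = c" "\<And>i :: nat. i < 1 \<Longrightarrow> \<sigma> a = b"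
    using homogeneous[OF saturated infinite_UNIV assms(1), of 1 "\<lambda>_. a" "\<lambda>_. b"] by blast
  from \<sigma>(3)[of 0] have "\<sigma> a = b" by simp
  with \<sigma>(1,2) show ?thesis by (rule that)
qed

text \<open>The main use of invariance: an automorphism over \<open>B\<close> carries one generic
  element to the other and preserves \<open>p\<close>, so the two fibres of \<open>T\<close> belong
  to the filter together.\<close>

lemma generically_section_conjugate:
  assumes "small B" "A \<subseteq> B" "generic a B" "generic b B" "definable_rel M B T"
  shows "generically {x. T x a} \<longleftrightarrow> generically {x. T x b}"
proof -
  have "generically {x. T x b}" if ab: "generic a B" "generic b B" and T: "generically {x. T x a}" for a b
  proof -
    obtain \<sigma> where \<sigma>: "automorphism M \<sigma>" "\<And>c. c \<in> B \<Longrightarrow> \<sigma> c = c" "\<sigma> a = b"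
      using generic_conjugate[OF assms(1) ab] by blast
    have "\<sigma> ` {x. T x a} \<subseteq> {x. T x b}"
      using definable_rel_automorphism[OF assms(5) \<sigma>(1,2)] \<sigma>(3) by blast
    moreover have "generically (\<sigma> ` {x. T x a})" using \<sigma> assms(2) T by (intro generically_automorphism) auto
    ultimately show ?thesis using generically_mono by blast
  qed
  then show ?thesis using assms(3,4) by blast
qed

section \<open>The pregeometry axioms\<close>

text \<open>Serves both closure operators, with \<open>K\<close> the realizations of
  \<open>p|A\<close> or the whole universe. Its hypotheses speak of finite extensions of
  \<open>A\<close>, which are small, so that homogeneity is available for them; finite character
  carries them over to arbitrary supersets of \<open>A\<close>.\<close>

lemma pregeometry_generic_closure:
  assumes regular: "\<And>F c b. finite F \<Longrightarrow> c \<in> K \<Longrightarrow> \<not> generic c (A \<union> F) \<Longrightarrow> generic b (A \<union> F) \<Longrightarrow>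
      generic b (insert c (A \<union> F))"
    and exchange: "\<And>F a b. finite F \<Longrightarrow> generic a (A \<union> F) \<Longrightarrow> generic b (insert a (A \<union> F)) \<Longrightarrow>
      generic a (insert b (A \<union> F))"
  shows "pregeometry_on (A \<union> K) (\<lambda>X. A \<union> (cl_type_over M A p X \<inter> K))"
proof -
  define cl where "cl X = A \<union> (cl_type_over M A p X \<inter> K)" for X
  have mem_cl: "a \<in> cl X \<longleftrightarrow> a \<in> A \<or> (a \<in> K \<and> \<not> generic a (X \<union> A))" for a X
    by (auto simp: cl_def cl_type_over_def cl_type_def)
  have regular': "generic b (insert c B)" if "A \<subseteq> B" "c \<in> K" "\<not> generic c B" "generic b B" for B b c
  proof (rule generic_finite_character)
    fix G assume G: "finite G" "G \<subseteq> insert c B"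
    \<comment> \<open>A finite \<open>F\<close> witnesses that \<open>c\<close> is not generic. It
      is kept in the base while genericity of \<open>b\<close> is tested on the finite set
      \<open>G\<close>.\<close>
    obtain F where F: "finite F" "F \<subseteq> B" "\<not> generic c F" using \<open>\<not> generic c B\<close> generic_finite_character[of B c] by blast
    let ?F = "F \<union> (G - {c})"
    have "generic b (insert c (A \<union> ?F))"
    proof (rule regular)
      show "\<not> generic c (A \<union> ?F)" using F generic_mono by blast
      show "generic b (A \<union> ?F)" using that(4) by (rule generic_mono) (use that F G in blast)
    qed (use F G that in auto)
    then show "generic b G" by (rule generic_mono) blast
  qed
  have exchange': "generic a (insert b B)" if "A \<subseteq> B" "generic a B" "generic b (insert a B)" for B a b
  proof (rule generic_finite_character)
    fix G assume G: "finite G" "G \<subseteq> insert b B"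
    have "generic a (insert b (A \<union> (G - {b})))"
    proof (rule exchange)
      show "generic a (A \<union> (G - {b}))" using that(2) by (rule generic_mono) (use that G in blast)
      show "generic b (insert a (A \<union> (G - {b})))" using that(3) by (rule generic_mono) (use that G in blast)
    qed (use G in simp)
    then show "generic a G" by (rule generic_mono) blast
  qed
  \<comment> \<open>Outside \<open>A\<close> this holds because no element of a set is generic over
    that set.\<close>
  have extensive: "X \<subseteq> cl X" if "X \<subseteq> A \<union> K" for X
    using that generic_not_mem unfolding mem_cl subset_iff by blast
  have mono: "cl X \<subseteq> cl Y" if "X \<subseteq> Y" for X Y
    using that generic_mono[of _ "Y \<union> A" "X \<union> A"] unfolding mem_cl subset_iff by blast
  have finitary: "\<exists>X0. finite X0 \<and> X0 \<subseteq> X \<and> a \<in> cl X0" if a: "a \<in> cl X" for a X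
  proof (cases "a \<in> A")
    case False
    then have "\<not> generic a (X \<union> A)" using a by (simp add: mem_cl)
    then obtain F where F: "finite F" "F \<subseteq> X \<union> A" "\<not> generic a F"
      using generic_finite_character[of "X \<union> A" a] by blast
    then have "\<not> generic a (F \<inter> X \<union> A)" using generic_mono[of a "F \<inter> X \<union> A" F] by blast
    then show ?thesis using a False F by (intro exI[of _ "F \<inter> X"]) (auto simp: mem_cl)
  qed (auto simp: mem_cl)
  have idem: "cl (cl X) \<subseteq> cl X" for X
  proof
    fix a assume a: "a \<in> cl (cl X)"
    show "a \<in> cl X"
    proof (rule ccontr)
      assume "a \<notin> cl X"
      with a have gen: "generic a (X \<union> A)" "\<not> generic a (cl X \<union> A)" by (auto simp: mem_cl)
      \<comment> \<open>Elements of \<open>G\<close> are added one at a time. Each is in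
        \<open>A\<close> or not generic over \<open>X \<union> A\<close>, hence not generic over the
        larger base either, and \<open>regular'\<close> keeps \<open>a\<close> generic.\<close>
      have "generic a (X \<union> A \<union> G)" if "finite G" "G \<subseteq> cl X \<union> A" for G
        using that
      proof (induction G)
        case empty
        then show ?case using gen by simp
      next
        case (insert c G)
        show ?case
        proof (cases "c \<in> A")
          case True
          then show ?thesis using insert by (simp add: insert_absorb)
        next
          case False
          then have "c \<in> K" "\<not> generic c (X \<union> A)" using insert.prems by (auto simp: mem_cl)
          then have "generic a (insert c (X \<union> A \<union> G))"
            using insert generic_mono[of c "X \<union> A \<union> G" "X \<union> A"] by (intro regular') auto
          then show ?thesis by simp
        qed
      qed
      then have "generic a G" if "finite G" "G \<subseteq> cl X \<union> A" for G
        using that generic_mono[of a "X \<union> A \<union> G" G] by blast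
      then have "generic a (cl X \<union> A)" by (rule generic_finite_character)
      with gen show False by simp
    qed
  qed
  have exch: "b \<in> cl (insert a X)" if "a \<in> cl (insert b X) - cl X" "b \<in> A \<union> K" for a b X
  proof (rule ccontr)
    assume "b \<notin> cl (insert a X)"
    with that have b: "generic b (insert a (X \<union> A))" by (auto simp: mem_cl)
    from that have a: "\<not> generic a (insert b (X \<union> A))" "generic a (X \<union> A)" by (auto simp: mem_cl)
    show False using exchange'[OF _ a(2) b] a(1) by simp
  qed
  have "pregeometry_on (A \<union> K) cl"
    unfolding pregeometry_on_def
  proof (intro conjI allI ballI impI)
    fix X assume X: "X \<subseteq> A \<union> K"
    show "cl X \<subseteq> A \<union> K" by (auto simp: mem_cl)
    have "cl X \<subseteq> A \<union> K" by (auto simp: mem_cl)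
    then show "cl (cl X) = cl X" using idem extensive by blast
    show "cl X = (\<Union>X0\<in>{X0. finite X0 \<and> X0 \<subseteq> X}. cl X0)" (is "_ = ?U")
    proof
      show "cl X \<subseteq> ?U" using finitary[of _ X] by blast
      show "?U \<subseteq> cl X" using mono[of _ X] by blast
    qed
    show "b \<in> cl (insert a X)" if "b \<in> A \<union> K" "a \<in> cl (insert b X) - cl X" for a b
      using exch that by blast
  next
    fix X Y assume "X \<subseteq> Y" "Y \<subseteq> A \<union> K"
    then show "X \<subseteq> cl X" "cl X \<subseteq> cl Y" using extensive[of X] mono[of X Y] by auto
  qed
  then show ?thesis by (simp add: cl_def[abs_def])
qed

section \<open>Morley sequences and powers of the type\<close>

definition morley_tuple :: "'m set \<Rightarrow> (nat \<Rightarrow> 'm) \<Rightarrow> nat \<Rightarrow> bool" where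
  "morley_tuple B e n \<longleftrightarrow> (\<forall>i<n. generic (e i) (B \<union> e ` {..<i}))"

lemma morley_tuple_mono:
  assumes "morley_tuple B' e n" "B \<subseteq> B'" "m \<le> n"
  shows "morley_tuple B e m"
  unfolding morley_tuple_def
proof (intro allI impI)
  fix i assume "i < m"
  then have "generic (e i) (B' \<union> e ` {..<i})" using assms(1,3) by (simp add: morley_tuple_def)
  then show "generic (e i) (B \<union> e ` {..<i})" by (rule generic_mono) (use assms(2) in blast)
qed

lemma morley_tuple_exists:
  assumes "small B"
  shows "\<exists>e. morley_tuple B e n"
proof (induction n)
  case (Suc n)
  then obtain e where e: "morley_tuple B e n" ..
  obtain a where a: "generic a (B \<union> e ` {..<n})"
    using generic_exists[OF small_Un[OF infinite_UNIV assms small_finite[OF infinite_UNIV]]] by blast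
  have "(e(n := a)) ` {..<i} = e ` {..<i}" if "i \<le> n" for i
    using that by (intro image_cong) auto
  with e a have "morley_tuple B (e(n := a)) (Suc n)"
    unfolding morley_tuple_def by (metis fun_upd_apply less_Suc_eq less_imp_le order_refl)
  then show ?case by blast
qed (simp add: morley_tuple_def)

text \<open>With \<open>n = Suc k\<close> this is the substitution in the definition of
  \<open>type_power\<close>.\<close>

definition instantiate :: "nat \<Rightarrow> (nat \<Rightarrow> 'm) \<Rightarrow> ('f, 'r, 'm) fm \<Rightarrow> ('f, 'r, 'm) fm" where
  "instantiate n e \<phi> = subst (\<lambda>i. if i < n then Par (e i) else Var (i - n)) \<phi>"

lemma instantiate_formulas:
  "\<phi> \<in> formulas M (Suc n) B \<Longrightarrow> instantiate n e \<phi> \<in> formulas M 1 (B \<union> e ` {..<n})"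
  by (auto simp: formulas_def instantiate_def fv_subst params_subst intro!: wf_subst split: if_splits)

lemma sat_instantiate:
  "\<phi> \<in> formulas M (Suc n) B \<Longrightarrow> sat M (\<lambda>_. x) (instantiate n e \<phi>) \<longleftrightarrow> sat M (e(n := x)) \<phi>"
  unfolding instantiate_def sat_subst by (erule sat_cong_formulas) auto

lemma generic_sat_iff:
  assumes "generic a B" "\<phi> \<in> formulas M 1 B"
  shows "\<phi> \<in> p \<longleftrightarrow> sat M (\<lambda>_. a) \<phi>"
proof -
  have "definable_set M B {x. sat M (\<lambda>_. x) \<phi>}" using assms(2) unfolding definable_set_def by blast
  then show ?thesis
    using generic_mem_iff[OF assms(1)] in_type_iff_generically[OF formulas_mono[OF assms(2) subset_UNIV]] by blast
qed

text \<open>Membership of \<open>\<phi>(d, x)\<close> in \<open>p\<close> depends only on the type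
  of \<open>d\<close> over \<open>C\<close>, by homogeneity and invariance. Hence the realization
  chosen in \<open>type_power\<close> is immaterial.\<close>

lemma instantiate_in_type_cong:
  assumes C: "small C" "A \<subseteq> C" and \<phi>: "\<phi> \<in> formulas M (Suc n) C"
    and same: "\<And>\<theta>. \<theta> \<in> formulas M n C \<Longrightarrow> sat M d \<theta> \<longleftrightarrow> sat M e \<theta>"
    and d: "instantiate n d \<phi> \<in> p"
  shows "instantiate n e \<phi> \<in> p"
proof -
  obtain \<sigma> where \<sigma>: "automorphism M \<sigma>" "\<And>c. c \<in> C \<Longrightarrow> \<sigma> c = c" "\<And>i. i < n \<Longrightarrow> \<sigma> (d i) = e i"
    using homogeneous[OF saturated infinite_UNIV C(1) same] by blast
  have "map_fm \<sigma> \<phi> = map_fm id \<phi>" using \<phi> \<sigma>(2) by (intro fm.map_cong) (auto simp: formulas_def)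
  then have map: "map_fm \<sigma> \<phi> = \<phi>" by (simp add: fm.map_id)
  \<comment> \<open>The image of \<open>instantiate n d \<phi>\<close> under \<open>\<sigma>\<close>
    is compared with \<open>instantiate n e \<phi>\<close> through the elements satisfying
    them.\<close>
  show ?thesis
  proof (rule type_upward)
    show "instantiate n e \<phi> \<in> formulas M 1 UNIV"
      using instantiate_formulas[OF \<phi>] formulas_mono by blast
    have "\<sigma> a = a" if "a \<in> A" for a using \<sigma>(2) that C(2) by blast
    then show "{map_fm \<sigma> (instantiate n d \<phi>)} \<subseteq> p" using type_automorphism[OF \<sigma>(1)] d by blast
    fix x assume "\<And>\<psi>. \<psi> \<in> {map_fm \<sigma> (instantiate n d \<phi>)} \<Longrightarrow> sat M (\<lambda>_. x) \<psi>"
    then have x: "sat M (\<lambda>_. x) (map_fm \<sigma> (instantiate n d \<phi>))" by blast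
    obtain y where y: "x = \<sigma> y" using \<sigma>(1) unfolding automorphism_def by (blast elim: bij_pointE)
    have "wf_fm M (instantiate n d \<phi>)" using instantiate_formulas[OF \<phi>, of d] by (simp add: formulas_def)
    then have "sat M (\<lambda>_. y) (instantiate n d \<phi>)"
      using x y sat_automorphism[OF \<sigma>(1), of _ "\<lambda>_. y"] by simp
    then have "sat M (d(n := y)) \<phi>" using sat_instantiate[OF \<phi>] by simp
    then have "sat M (\<lambda>i. \<sigma> ((d(n := y)) i)) \<phi>"
      using sat_automorphism[OF \<sigma>(1), of \<phi>] \<phi> map by (simp add: formulas_def del: fun_upd_apply)
    moreover have "sat M (\<lambda>i. \<sigma> ((d(n := y)) i)) \<phi> \<longleftrightarrow> sat M (e(n := x)) \<phi>"
      using \<phi> by (rule sat_cong_formulas) (use \<sigma>(3) y in auto)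
    ultimately show "sat M (\<lambda>_. x) (instantiate n e \<phi>)" using sat_instantiate[OF \<phi>] by simp
  qed simp
qed

lemma type_power_formulas: "type_power M A p (Suc k) \<subseteq> formulas M (Suc k) UNIV"
  using type_formulas by (cases k) auto

text \<open>Replaces the recursive definition by truth at one Morley tuple. The exponent is
  \<open>Suc k\<close> because the value of \<open>type_power\<close> at 0 is a dummy.\<close>

lemma type_power_iff:
  assumes "\<phi> \<in> formulas M (Suc k) UNIV" "morley_tuple (A \<union> params \<phi>) e (Suc k)"
  shows "\<phi> \<in> type_power M A p (Suc k) \<longleftrightarrow> sat M e \<phi>"
  using assms
proof (induction k arbitrary: \<phi> e)
  case 0
  then have "generic (e 0) (A \<union> params \<phi>)" by (simp add: morley_tuple_def)
  moreover have "\<phi> \<in> formulas M 1 (A \<union> params \<phi>)" using 0 by (auto simp: formulas_def)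
  moreover have "sat M (\<lambda>_. e 0) \<phi> \<longleftrightarrow> sat M e \<phi>" using 0(1) by (rule sat_cong_formulas) simp
  ultimately show ?case by (simp add: generic_sat_iff)
next
  case (Suc k)
  let ?C = "A \<union> params \<phi>" and ?q = "type_power M A p (Suc k)"
  have C: "small ?C" "A \<subseteq> ?C" using small_extension finite_params by auto
  have \<phi>: "\<phi> \<in> formulas M (Suc (Suc k)) ?C" using Suc.prems(1) by (auto simp: formulas_def)
  have q_iff: "\<theta> \<in> ?q \<longleftrightarrow> sat M e \<theta>" if "\<theta> \<in> formulas M (Suc k) ?C" for \<theta>
  proof (rule Suc.IH)
    show "\<theta> \<in> formulas M (Suc k) UNIV" using that formulas_mono by blast
    show "morley_tuple (A \<union> params \<theta>) e (Suc k)"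
      using Suc.prems(2) by (rule morley_tuple_mono) (use that in \<open>auto simp: formulas_def\<close>)
  qed
  have e: "realizes M e (tp_restrict ?q ?C)"
    unfolding realizes_def tp_restrict_def
  proof safe
    fix \<theta> assume "\<theta> \<in> ?q" "params \<theta> \<subseteq> ?C"
    moreover from this have "\<theta> \<in> formulas M (Suc k) ?C"
      using type_power_formulas by (fastforce simp: formulas_def)
    ultimately show "sat M e \<theta>" using q_iff by blast
  qed
  \<comment> \<open>By \<open>q_iff\<close> the lower power decides every formula over
    \<open>?C\<close>, so any realization \<open>d\<close> of it has the same type over
    \<open>?C\<close> as \<open>e\<close>.\<close>
  have "sat M d \<theta> \<longleftrightarrow> sat M e \<theta>"
    if d: "realizes M d (tp_restrict ?q ?C)" and \<theta>: "\<theta> \<in> formulas M (Suc k) ?C" for d \<theta>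
  proof -
    have *: "sat M e \<psi> \<Longrightarrow> sat M d \<psi>" if "\<psi> \<in> formulas M (Suc k) ?C" for \<psi>
      using d q_iff[OF that] that by (auto simp: realizes_def tp_restrict_def formulas_def)
    moreover have "Neg \<theta> \<in> formulas M (Suc k) ?C" using \<theta> by (simp add: formulas_def)
    ultimately show ?thesis using *[OF \<theta>] *[of "Neg \<theta>"] by auto
  qed
  then have inst: "instantiate (Suc k) d \<phi> \<in> p \<Longrightarrow> instantiate (Suc k) e \<phi> \<in> p"
    if "realizes M d (tp_restrict ?q ?C)" for d
    using instantiate_in_type_cong[OF C \<phi>] that by blast
  have "\<phi> \<in> type_power M A p (Suc (Suc k)) \<longleftrightarrow>
    (\<exists>d. realizes M d (tp_restrict ?q ?C) \<and> instantiate (Suc k) d \<phi> \<in> p)"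
    using Suc.prems(1) by (simp add: instantiate_def)
  also have "\<dots> \<longleftrightarrow> instantiate (Suc k) e \<phi> \<in> p" using inst e by blast
  also have "\<dots> \<longleftrightarrow> sat M (\<lambda>_. e (Suc k)) (instantiate (Suc k) e \<phi>)"
    using Suc.prems(2) instantiate_formulas[OF \<phi>] by (intro generic_sat_iff) (auto simp: morley_tuple_def)
  also have "\<dots> \<longleftrightarrow> sat M e \<phi>" using sat_instantiate[OF \<phi>] by simp
  finally show ?case .
qed

section \<open>Morley pairs, exchange and symmetry\<close>

text \<open>All Morley pairs over \<open>B\<close> have the same type over \<open>B\<close>:
  conjugation replaces the first coordinate in the fibre, and genericity of the second decides
  membership.\<close>

lemma generic_pair_rel:
  assumes B: "small B" "A \<subseteq> B" and T: "definable_rel M B T"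
    and "generic a B" "generic b (insert a B)" "T a b"
    and "generic x B" "generic y (insert x B)"
  shows "T x y"
proof -
  have sect: "definable_set M (insert z B) {y. T z y}" for z
    using definable_rel_section[OF definable_rel_swap[OF T], of z] .
  have "generically {y. T a y}" using assms generic_mem_iff[OF _ sect, of b a] by blast
  then have "generically {y. T x y}"
    using generically_section_conjugate[OF B _ _ definable_rel_swap[OF T]] assms by blast
  then show ?thesis using assms generic_mem_iff[OF _ sect, of y x] by blast
qed

text \<open>If exchange fails, some relation \<open>T\<close> over \<open>A \<union> F\<close> holds
  at \<open>(a, b)\<close> although \<open>T(x, b)\<close> is not in \<open>p\<close>. By
  conjugation \<open>T(x, a)\<close> is not in \<open>p\<close>, so \<open>T\<close> fails at
  \<open>(b, a)\<close>, against symmetry of the second power.\<close>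

lemma symmetric_exchange:
  assumes sym: "symmetric_type M A p" and F: "finite F"
    and a: "generic a (A \<union> F)" and b: "generic b (insert a (A \<union> F))"
  shows "generic a (insert b (A \<union> F))"
proof (rule ccontr)
  let ?B = "A \<union> F"
  assume "\<not> generic a (insert b ?B)"
  then obtain S where S: "definable_set M (insert b ?B) S" "a \<in> S" "\<not> generically S"
    by (rule not_genericE)
  from S(1) obtain T where T: "definable_rel M ?B T" "\<And>x. x \<in> S \<longleftrightarrow> T x b"
    by (rule definable_set_as_section) blast
  have "S = {x. T x b}" using T(2) by blast
  have b': "generic b ?B" using b by (rule generic_mono) blast
  have "\<not> generically {x. T x a}"
    using generically_section_conjugate[OF small_extension[OF F] _ a b' T(1)] S(3) \<open>S = _\<close> by simp
  then have not_ba: "\<not> T b a"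
    using generic_mem_iff[OF b definable_rel_section[OF T(1)]] by simp
  obtain \<phi> where \<phi>: "\<phi> \<in> formulas M 2 ?B" "\<And>x y. T x y \<longleftrightarrow> sat M (case_nat x (\<lambda>_. y)) \<phi>"
    using T(1) unfolding definable_rel_def by blast
  let ?\<phi>' = "subst (\<lambda>i. Var (Transposition.transpose 0 1 i)) \<phi>" and ?e = "case_nat a (\<lambda>_. b)"
  have \<phi>': "?\<phi>' \<in> formulas M 2 ?B"
    using \<phi>(1) by (auto simp: formulas_def fv_subst params_subst transpose_def intro!: wf_subst split: if_splits)
  have perm: "Transposition.transpose 0 (1::nat) permutes {..<2}" by (rule permutes_swap_id) auto
  have "morley_tuple ?B ?e 2"
    using a b by (auto simp: morley_tuple_def less_2_cases_iff lessThan_Suc)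
  then have iff: "\<psi> \<in> type_power M A p 2 \<longleftrightarrow> sat M ?e \<psi>" if "\<psi> \<in> formulas M 2 ?B" for \<psi>
    using type_power_iff[of \<psi> 1 ?e] morley_tuple_mono[of ?B ?e 2 "A \<union> params \<psi>" 2] that
    by (auto simp: formulas_def numeral_2_eq_2)
  have "\<phi> \<in> type_power M A p 2" using iff[OF \<phi>(1)] \<phi>(2) T(2) S(2) by blast
  moreover have "\<phi> \<in> formulas M 2 UNIV" using \<phi>(1) formulas_mono by blast
  ultimately have "?\<phi>' \<in> type_power M A p 2"
    using sym perm unfolding symmetric_type_def by (metis one_le_numeral)
  then have "sat M ?e ?\<phi>'" using iff[OF \<phi>'] by blast
  moreover have "sat M ?e ?\<phi>' \<longleftrightarrow> sat M (case_nat b (\<lambda>_. a)) \<phi>"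
    unfolding sat_subst using \<phi>(1) by (rule sat_cong_formulas) (auto simp: transpose_def less_2_cases_iff)
  ultimately show False using not_ba \<phi>(2) by blast
qed

text \<open>Exchange makes each entry of a Morley tuple generic over all the others, so a permuted
  tuple is again a Morley tuple. By \<open>type_power_iff\<close> both tuples decide membership in
  the power.\<close>

lemma exchange_symmetric:
  assumes exchange: "\<And>F a b. finite F \<Longrightarrow> generic a (A \<union> F) \<Longrightarrow> generic b (insert a (A \<union> F)) \<Longrightarrow>
      generic a (insert b (A \<union> F))"
  shows "symmetric_type M A p"
  unfolding symmetric_type_def
proof (intro allI impI ballI)
  fix n :: nat and \<phi> \<pi>
  assume n: "1 \<le> n" and \<phi>: "\<phi> \<in> formulas M n UNIV" and \<pi>: "\<pi> permutes {..<n}"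
  let ?B = "A \<union> params \<phi>"
  obtain e where e: "morley_tuple ?B e n"
    using morley_tuple_exists[OF small_extension[OF finite_params]] by blast
  \<comment> \<open>Induction on \<open>m\<close>: the new entry \<open>e m\<close> is generic over
    everything before it, so it can be exchanged with \<open>e i\<close> over the remaining
    entries.\<close>
  have indep: "generic (e i) (?B \<union> e ` ({..<m} - {i}))" if "i < m" "m \<le> n" for i m
    using that
  proof (induction m)
    case (Suc m)
    have gen: "generic (e m) (?B \<union> e ` {..<m})" using e Suc.prems by (simp add: morley_tuple_def)
    show ?case
    proof (cases "i = m")
      case True
      then have "{..<Suc m} - {i} = {..<m}" by auto
      with gen True show ?thesis by simp
    next
      case False
      let ?F = "params \<phi> \<union> e ` ({..<m} - {i})"
      have "i < m" using False Suc.prems by simp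
      then have "e ` {..<m} = insert (e i) (e ` ({..<m} - {i}))" by blast
      then have gen': "generic (e m) (insert (e i) (A \<union> ?F))" using gen by (simp add: Un_assoc)
      have "generic (e i) (A \<union> ?F)" using Suc \<open>i < m\<close> by (simp add: Un_assoc)
      then have "generic (e i) (insert (e m) (A \<union> ?F))"
        by (rule exchange[rotated, OF _ gen']) (simp add: finite_params)
      moreover have "e ` ({..<Suc m} - {i}) = insert (e m) (e ` ({..<m} - {i}))"
        using False by (auto simp: less_Suc_eq)
      ultimately show ?thesis by (simp add: Un_assoc)
    qed
  qed simp
  have "morley_tuple ?B (e \<circ> \<pi>) n"
    unfolding morley_tuple_def
  proof (intro allI impI)
    fix i assume i: "i < n"
    have "\<pi> j < n" if "j < n" for j using permutes_in_image[OF \<pi>, of j] that by simp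
    \<comment> \<open>Injectivity of \<open>\<pi>\<close> keeps index \<open>\<pi> i\<close> out of
      the places used before \<open>i\<close>, so \<open>indep\<close> with \<open>m = n\<close>
      applies.\<close>
    moreover have "\<pi> j \<noteq> \<pi> i" if "j < i" for j using permutes_inj[OF \<pi>] that by (auto dest: injD)
    ultimately have "\<pi> i < n" "(e \<circ> \<pi>) ` {..<i} \<subseteq> e ` ({..<n} - {\<pi> i})" using i by auto
    then show "generic ((e \<circ> \<pi>) i) (?B \<union> (e \<circ> \<pi>) ` {..<i})"
      using generic_mono[OF indep[of "\<pi> i" n] Un_mono[OF subset_refl]] by simp
  qed
  moreover obtain k where k: "n = Suc k" using n by (cases n) auto
  ultimately have "\<phi> \<in> type_power M A p n \<longleftrightarrow> sat M (e \<circ> \<pi>) \<phi>"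
    using type_power_iff \<phi> by blast
  also have "sat M (e \<circ> \<pi>) \<phi> \<longleftrightarrow> sat M e (subst (\<lambda>i. Var (\<pi> i)) \<phi>)"
    by (simp add: sat_subst comp_def)
  also have "\<dots> \<longleftrightarrow> subst (\<lambda>i. Var (\<pi> i)) \<phi> \<in> type_power M A p n"
  proof -
    have "\<pi> i < n" if "i < n" for i using permutes_in_image[OF \<pi>, of i] that by simp
    then have "subst (\<lambda>i. Var (\<pi> i)) \<phi> \<in> formulas M n UNIV"
      using \<phi> by (auto simp: formulas_def fv_subst intro!: wf_subst)
    moreover have "params (subst (\<lambda>i. Var (\<pi> i)) \<phi>) = params \<phi>" by (simp add: params_subst)
    ultimately show ?thesis using type_power_iff[of _ k e] e k by simp
  qed
  finally show "\<phi> \<in> type_power M A p n \<longleftrightarrow> subst (\<lambda>i. Var (\<pi> i)) \<phi> \<in> type_power M A p n" .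
qed

section \<open>Consequences of regularity\<close>

lemma realizes_or_entails_generic:
  assumes "realizes_or_entails M p B c" "\<not> generic c B" "generic b B"
  shows "generic b (insert c B)"
  using assms unfolding realizes_or_entails_def entails_def realizes_def by (meson subsetD)

text \<open>
  Strong regularity is witnessed over some set \<open>C\<close>, which has nothing to do with \<open>A\<close>.  By
  homogeneity \<open>C\<close> can be moved over \<open>B\<close> so that \<open>b\<close> becomes generic over it; invariance of
  \<open>p\<close> over \<open>A\<close> makes the moved set a witness too.
\<close>

lemma strongly_regular_generic:
  assumes sreg: "strongly_regular M p (Eq (Var 0) (Var 0))"
    and B: "small B" "A \<subseteq> B" and c: "\<not> generic c B" and b: "generic b B"
  shows "generic b (insert c B)"
proof -
  obtain C where C: "small C" "\<And>B a. C \<subseteq> B \<Longrightarrow> realizes_or_entails M p B a"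
    using sreg unfolding strongly_regular_def by auto
  obtain b' where b': "generic b' (B \<union> C)" using generic_exists small_Un[OF infinite_UNIV B(1) C(1)] by blast
  have "generic b' B" using b' by (rule generic_mono) blast
  then obtain \<sigma> where \<sigma>: "automorphism M \<sigma>" "\<And>x. x \<in> B \<Longrightarrow> \<sigma> x = x" "\<sigma> b' = b"
    using generic_conjugate[OF B(1) _ b] by blast
  have \<sigma>A: "\<sigma> a = a" if "a \<in> A" for a using \<sigma>(2) B(2) that by blast
  obtain c' where c': "c = \<sigma> c'" using \<sigma>(1) unfolding automorphism_def by (blast elim: bij_pointE)
  have "\<sigma> ` B = B" using \<sigma>(2) by simp
  then have "\<not> generic c' B" using c c' generic_automorphism[OF \<sigma>(1) \<sigma>A] by metis
  then have "\<not> generic c' (B \<union> C)" using generic_mono by blast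
  then have "generic b' (insert c' (B \<union> C))"
    using C(2)[of "B \<union> C" c'] b' by (intro realizes_or_entails_generic) auto
  then have "generic b (\<sigma> ` insert c' (B \<union> C))"
    using generic_automorphism[OF \<sigma>(1) \<sigma>A] \<sigma>(3) by metis
  then show ?thesis by (rule generic_mono) (use c' \<open>\<sigma> ` B = B\<close> in blast)
qed

text \<open>Compactness: a finite part of \<open>p|D\<close> amounts to one
  \<open>D\<close>-definable set in the filter, which meets \<open>U\<close>. The parameters of
  \<open>U\<close> may lie outside \<open>D\<close>, so saturation is applied over
  \<open>B\<close>.\<close>

lemma generic_in_definable_set:
  assumes B: "small B" "D \<subseteq> B" and U: "definable_set M B U"
    and meets: "\<And>S. definable_set M D S \<Longrightarrow> generically S \<Longrightarrow> S \<inter> U \<noteq> {}"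
  shows "\<exists>z\<in>U. generic z D"
proof -
  obtain \<psi> where \<psi>: "\<psi> \<in> formulas M 1 B" "\<And>x. x \<in> U \<longleftrightarrow> sat M (\<lambda>_. x) \<psi>"
    using U unfolding definable_set_def by blast
  let ?\<Phi> = "insert \<psi> (tp_restrict p D)"
  have D: "tp_restrict p D \<subseteq> formulas M 1 D" using type_formulas by (auto simp: tp_restrict_def formulas_def)
  have "finitely_satisfiable M ?\<Phi>"
    unfolding finitely_satisfiable_def
  proof (intro allI impI)
    fix F assume F: "F \<subseteq> ?\<Phi>" "finite F"
    then obtain \<phi>s where \<phi>s: "set \<phi>s = F - {\<psi>}" using finite_list by blast
    have sub: "set \<phi>s \<subseteq> tp_restrict p D" using F \<phi>s by blast
    have conjs: "conjs \<phi>s \<in> formulas M 1 D" using sub D by (intro conjs_formulas) auto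
    then have "conjs \<phi>s \<in> p"
      using sub formulas_mono[OF conjs subset_UNIV]
      by (intro type_upward[of _ "set \<phi>s"]) (auto simp: sat_conjs tp_restrict_def)
    then have "generically {x. sat M (\<lambda>_. x) (conjs \<phi>s)}" unfolding generically_def by blast
    moreover have "definable_set M D {x. sat M (\<lambda>_. x) (conjs \<phi>s)}"
      using conjs unfolding definable_set_def by blast
    ultimately obtain x where "sat M (\<lambda>_. x) (conjs \<phi>s)" "sat M (\<lambda>_. x) \<psi>" using meets \<psi>(2) by blast
    then have "realizes1 M x F" using \<phi>s by (auto simp: realizes_def sat_conjs)
    then show "\<exists>e. realizes M e F" by blast
  qed
  moreover have "?\<Phi> \<subseteq> formulas M 1 B" using D \<psi>(1) formulas_mono[OF _ B(2)] by blast
  ultimately obtain z where "realizes1 M z ?\<Phi>" using saturated B(1) unfolding saturated_def by metis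
  then show ?thesis using \<psi>(2) by (auto simp: realizes_def)
qed

section \<open>The order in the asymmetric case\<close>

text \<open>The relation obtained is a quasi-order. Its behaviour is checked at one Morley pair over
  the large base \<open>?D\<close>, and \<open>generic_pair_rel\<close> spreads it to all Morley
  pairs over the finite extension \<open>A \<union> G\<close>.\<close>

lemma asymmetric_order:
  assumes C: "small C" "regular_over M C p" and F: "finite F"
    and a0: "generic a0 (A \<union> F)" and b0: "generic b0 (insert a0 (A \<union> F))"
    and asym: "\<not> generic a0 (insert b0 (A \<union> F))"
  obtains G T where "finite G" "definable_rel M (A \<union> G) T" "\<And>x. T x x"
    "\<And>x y z. T x y \<Longrightarrow> T y z \<Longrightarrow> T x z"
    "\<And>x y. generic x (A \<union> G) \<Longrightarrow> generic y (insert x (A \<union> G)) \<Longrightarrow> T x y \<and> \<not> T y x"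
proof -
  let ?B = "A \<union> F"
  let ?D = "?B \<union> C"
  have B: "small ?B" "A \<subseteq> ?B" using small_extension[OF F] by auto
  have D: "small ?D" using small_Un[OF infinite_UNIV B(1) C(1)] .
  obtain S where S: "definable_set M (insert b0 ?B) S" "a0 \<in> S" "\<not> generically S"
    using asym by (rule not_genericE)
  from S(1) obtain T where T: "definable_rel M ?B T" "\<And>x. x \<in> S \<longleftrightarrow> T x b0"
    by (rule definable_set_as_section) blast
  have "S = {x. T x b0}" using T(2) by blast
  \<comment> \<open>\<open>T\<close> holds at every Morley pair over \<open>?B\<close> because it
    does at \<open>(a0, b0)\<close>; by \<open>thin\<close> below it fails at the reversed
    pairs.\<close>
  have below: "T x y" if "generic x ?B" "generic y (insert x ?B)" for x y
    using generic_pair_rel[OF B T(1) a0 b0 _ that] T(2) S(2) by blast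
  have b0': "generic b0 ?B" using b0 by (rule generic_mono) blast
  have thin: "\<not> generically {x. T x y}" if "generic y ?B" for y
    using generically_section_conjugate[OF B that b0' T(1)] S(3) \<open>S = _\<close> by simp
  have not_below: "\<not> T x y" if "generic y ?B" "generic x (insert y ?B)" for x y
    using generic_mem_iff[OF that(2) definable_rel_section[OF T(1)]] thin[OF that(1)] by simp
  \<comment> \<open>The elements \<open>a\<close>, \<open>c\<close>, \<open>b\<close>, in this
    order, form a Morley sequence over \<open>?D\<close>; \<open>c\<close> will separate the fibres
    over \<open>a\<close> and \<open>b\<close>.\<close>
  obtain a where a: "generic a ?D" using generic_exists[OF D] ..
  have small_ins: "small (insert x X)" if "small X" for x :: 'm and X
    using small_Un[OF infinite_UNIV small_finite[OF infinite_UNIV, of "{x}"] that] by simp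
  obtain c where c: "generic c (insert a ?D)" using generic_exists small_ins[OF D] by blast
  obtain b where b: "generic b (insert c (insert a ?D))"
    using generic_exists small_ins[OF small_ins[OF D]] by blast
  have ba: "generic b (insert a ?D)" using b by (rule generic_mono) blast
  have aB: "generic a ?B" using a by (rule generic_mono) blast
  \<comment> \<open>\<open>Q\<close> is the set defined by theta. If no such set existed, saturation
    would give one \<open>z\<close> generic over \<open>?D\<close> with \<open>T z a\<close> and not
    \<open>T z b\<close>.\<close>
  have "\<exists>Q. definable_set M ?D Q \<and> generically Q \<and> (\<forall>z\<in>Q. T z a \<longrightarrow> T z b)"
  proof (rule ccontr)
    assume no: "\<not> ?thesis"
    let ?U = "{z. T z a \<and> \<not> T z b}"
    have TD: "definable_rel M ?D T" using T(1) by (rule definable_rel_mono) blast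
    have "definable_rel M (insert a ?D) (\<lambda>z y. z \<in> {z. T z a} \<and> \<not> T z y)"
      using definable_rel_section[OF TD] definable_rel_mono[OF definable_rel_Not[OF TD]]
      by (intro definable_rel_restrict) blast+
    then have "definable_set M (insert b (insert a ?D)) ?U" using definable_rel_section[of M _ _ b] by fastforce
    then obtain z where z: "z \<in> ?U" "generic z ?D"
      using generic_in_definable_set[of "insert b (insert a ?D)" ?D ?U] small_ins[OF small_ins[OF D]] no by blast
    \<comment> \<open>Since \<open>T(x, a)\<close> is not in \<open>p\<close>, \<open>T z a\<close>
      rules out genericity over \<open>a\<close>. Regularity over \<open>C\<close> then keeps
      \<open>b\<close> generic when \<open>z\<close> is added, so \<open>(z, b)\<close> is a Morley
      pair and \<open>T z b\<close> holds.\<close>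
    have "\<not> generic z (insert a ?D)"
      using generic_mem_iff[OF _ definable_rel_section[OF TD], of z a] z(1) thin[OF aB] by blast
    moreover have "generic z C" using z(2) by (rule generic_mono) blast
    moreover from this have "realizes_or_entails M p (insert a ?D) z"
      using C(2) unfolding regular_over_def by (simp add: subset_insertI2)
    ultimately have "generic b (insert z (insert a ?D))"
      using ba realizes_or_entails_generic by blast
    then have "generic b (insert z ?B)" by (rule generic_mono) blast
    moreover have "generic z ?B" using z(2) by (rule generic_mono) blast
    ultimately show False using below z(1) by blast
  qed
  then obtain Q where Q: "definable_set M ?D Q" "generically Q" "\<And>z. z \<in> Q \<Longrightarrow> T z a \<Longrightarrow> T z b" by blast
  define T' where "T' z y \<longleftrightarrow> z \<in> Q \<and> T z y" for z y
  define R where "R x y \<longleftrightarrow> (\<forall>z. T' z x \<longrightarrow> T' z y)" for x y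
  have definable_T': "definable_rel M ?D T'"
    unfolding T'_def[abs_def] using T(1) Q(1) by (intro definable_rel_restrict) (auto intro: definable_rel_mono)
  \<comment> \<open>\<open>G\<close> collects the finitely many parameters of \<open>T'\<close>,
    possibly some from \<open>C\<close>. Since \<open>A \<union> G\<close> is contained in
    \<open>?D\<close>, \<open>(a, b)\<close> is a Morley pair over it as well.\<close>
  obtain G where G: "finite G" "G \<subseteq> ?D" "definable_rel M G T'"
    using definable_rel_finite[OF definable_T'] by auto
  let ?E = "A \<union> G"
  have E: "small ?E" "A \<subseteq> ?E" "?E \<subseteq> ?D" using small_extension[OF G(1)] G(2) by auto
  have RE: "definable_rel M ?E R"
    unfolding R_def[abs_def] using G(3) by (intro definable_rel_fibre_inclusion) (rule definable_rel_mono, auto)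
  have "R a b" using Q(3) by (auto simp: R_def T'_def)
  \<comment> \<open>\<open>c\<close> lies in the fibre of \<open>T'\<close> over \<open>b\<close>
    and not in the one over \<open>a\<close>, so the inclusion of fibres is proper.\<close>
  have "c \<in> Q" using c Q generic_mem_iff[OF generic_mono[OF c] Q(1)] by blast
  moreover have "T c b"
    using below[OF generic_mono[OF c] generic_mono[OF b]] by blast
  moreover have "\<not> T c a" using not_below[OF aB generic_mono[OF c]] by blast
  ultimately have "\<not> R b a" by (auto simp: R_def T'_def)
  have aE: "generic a ?E" using a by (rule generic_mono) (use E in blast)
  have bE: "generic b (insert a ?E)" using ba by (rule generic_mono) (use E in blast)
  show ?thesis
  proof (rule that[OF G(1) RE])
    show "R x x" for x by (simp add: R_def)
    show "R x z" if "R x y" "R y z" for x y z using that by (simp add: R_def)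
    show "R x y \<and> \<not> R y x" if "generic x ?E" "generic y (insert x ?E)" for x y
      using generic_pair_rel[OF E(1,2) RE aE bE \<open>R a b\<close> that]
        generic_pair_rel[OF E(1,2) definable_rel_Not[OF definable_rel_swap[OF RE]] aE bE \<open>\<not> R b a\<close> that]
      by blast
  qed
qed

end

section \<open>The symmetric and the asymmetric case\<close>

theorem theorem1:
  fixes M :: "('f, 'r, 'm) model" and A :: "'m set" and p :: "('f, 'r, 'm) fm set"
  assumes "saturated M"
    and "small A"
    and "global_type M p"
    and "invariant_over M A p"
    and "regular M p"
  shows
    "(symmetric_type M A p \<longrightarrow>
        (regular_over M A p \<longrightarrow>
           pregeometry_on (A \<union> realizations M (tp_restrict p A)) (cl_local M A p)) \<and>
        (strongly_regular M p (Eq (Var 0) (Var 0)) \<longrightarrow>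
           pregeometry_on UNIV (cl_type_over M A p))) \<and>
     (\<not> symmetric_type M A p \<longrightarrow>
        (\<exists>A0 \<psi>. A \<subseteq> A0 \<and> finite (A0 - A) \<and> \<psi> \<in> formulas M 2 A0 \<and>
           partial_order_on UNIV (definable_relation M \<psi>) \<and>
           (\<forall>(r :: 'm rel) a. morley_sequence M p A0 r a \<longrightarrow>
              strictly_increasing r (definable_relation M \<psi>) a)))"
proof (intro conjI impI)
  interpret invariant_type M A p
    using assms by unfold_locales (auto simp: regular_def)
  {
    assume sym: "symmetric_type M A p" and reg: "regular_over M A p"
    have "pregeometry_on (A \<union> realizations M (tp_restrict p A))
      (\<lambda>X. A \<union> (cl_type_over M A p X \<inter> realizations M (tp_restrict p A)))"
    proof (rule pregeometry_generic_closure[OF _ symmetric_exchange[OF sym]])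
      fix F c b
      assume "c \<in> realizations M (tp_restrict p A)" "\<not> generic c (A \<union> F)" "generic b (A \<union> F)"
      then show "generic b (insert c (A \<union> F))"
        \<comment> \<open>Regularity over \<open>A\<close> applies with base
          \<open>A \<union> F\<close>, because \<open>c\<close> realizes \<open>p|A\<close>.\<close>
        using reg by (intro realizes_or_entails_generic) (auto simp: regular_over_def realizations_def)
    qed
    then show "pregeometry_on (A \<union> realizations M (tp_restrict p A)) (cl_local M A p)"
      by (simp add: cl_local_def[abs_def])
  next
    assume sym: "symmetric_type M A p" and sreg: "strongly_regular M p (Eq (Var 0) (Var 0))"
    have "pregeometry_on (A \<union> UNIV) (\<lambda>X. A \<union> (cl_type_over M A p X \<inter> UNIV))"
      using strongly_regular_generic[OF sreg small_extension]
      by (intro pregeometry_generic_closure[OF _ symmetric_exchange[OF sym]]) auto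
    \<comment> \<open>The closure already contains \<open>A\<close>, since no element of
      \<open>A\<close> is generic over a superset of \<open>A\<close>.\<close>
    moreover have "A \<union> (cl_type_over M A p X \<inter> UNIV) = cl_type_over M A p X" for X
      using generic_not_mem by (auto simp: cl_type_over_def cl_type_def)
    ultimately show "pregeometry_on UNIV (cl_type_over M A p)" by simp
  next
    assume "\<not> symmetric_type M A p"
    then obtain F a b where asym: "finite F" "generic a (A \<union> F)" "generic b (insert a (A \<union> F))"
      "\<not> generic a (insert b (A \<union> F))"
      using exchange_symmetric by blast
    obtain C where C: "small C" "regular_over M C p" using assms(5) unfolding regular_def by blast
    obtain G T where G: "finite G" and T: "definable_rel M (A \<union> G) T" "\<And>x. T x x"
        "\<And>x y z. T x y \<Longrightarrow> T y z \<Longrightarrow> T x z"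
      and incr: "\<And>x y. generic x (A \<union> G) \<Longrightarrow> generic y (insert x (A \<union> G)) \<Longrightarrow> T x y \<and> \<not> T y x"
      using asymmetric_order[OF C asym] by blast
    obtain \<psi> where \<psi>: "\<psi> \<in> formulas M 2 (A \<union> G)"
      "\<And>x y. x = y \<or> T x y \<and> \<not> T y x \<longleftrightarrow> sat M (case_nat x (\<lambda>_. y)) \<psi>"
      using definable_rel_strict_or_eq[OF T(1)] unfolding definable_rel_def by blast
    have "(\<lambda>_. y)(0 := x) = case_nat x (\<lambda>_. y)" for x y :: 'm
      by (auto simp: fun_eq_iff split: nat.split)
    then have rel: "(x, y) \<in> definable_relation M \<psi> \<longleftrightarrow> x = y \<or> T x y \<and> \<not> T y x" for x y
      by (simp add: definable_relation_def \<psi>(2))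
    have "partial_order_on UNIV (definable_relation M \<psi>)"
      unfolding order_on_defs
    proof (intro conjI)
      show "refl (definable_relation M \<psi>)" by (simp add: refl_on_def rel)
      show "trans (definable_relation M \<psi>)"
      proof (rule transI)
        fix x y z assume "(x, y) \<in> definable_relation M \<psi>" "(y, z) \<in> definable_relation M \<psi>"
        then show "(x, z) \<in> definable_relation M \<psi>"
          \<comment> \<open>If \<open>T z x\<close> held, then with \<open>T x y\<close> it would
            give \<open>T z y\<close>, although \<open>y\<close> is strictly below
            \<open>z\<close>.\<close>
          unfolding rel using T(3)[of x y z] T(3)[of z x y] by blast
      qed
      show "antisym (definable_relation M \<psi>)" by (rule antisymI) (unfold rel, blast)
    qed simp_all
    moreover have "strictly_increasing r (definable_relation M \<psi>) a"
      if "morley_sequence M p (A \<union> G) r a" for r :: "'m rel" and a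
      unfolding strictly_increasing_def
    proof (intro allI impI)
      fix i j assume ij: "(i, j) \<in> r \<and> i \<noteq> j"
      then have "generic (a i) (A \<union> G \<union> a ` underS r i)" "generic (a j) (A \<union> G \<union> a ` underS r j)"
        using that by (auto simp: morley_sequence_def Field_def)
      \<comment> \<open>Since \<open>i\<close> precedes \<open>j\<close>, the element
        \<open>a i\<close> is among the parameters over which \<open>a j\<close> is generic, so the
        two form a Morley pair over \<open>A \<union> G\<close>.\<close>
      moreover have "a i \<in> a ` underS r j" using ij by (auto simp: underS_def)
      ultimately have "generic (a i) (A \<union> G)" "generic (a j) (insert (a i) (A \<union> G))"
        by (auto elim!: generic_mono)
      then show "(a i, a j) \<in> definable_relation M \<psi> \<and> a i \<noteq> a j"
        using incr[of "a i" "a j"] rel[of "a i" "a j"] by auto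
    qed
    ultimately show "\<exists>A0 \<psi>. A \<subseteq> A0 \<and> finite (A0 - A) \<and> \<psi> \<in> formulas M 2 A0 \<and>
        partial_order_on UNIV (definable_relation M \<psi>) \<and>
        (\<forall>(r :: 'm rel) a. morley_sequence M p A0 r a \<longrightarrow>
          strictly_increasing r (definable_relation M \<psi>) a)"
      using G \<psi>(1) by (intro exI[of _ "A \<union> G"] exI[of _ \<psi>]) (auto intro: finite_subset)
  }
qed

end
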